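(* Let $V_H\subset V=[H_0^1(\Omega)]^d$ and $Q_{H,1},Q_{H,2}\subset Q=H_0^1(\Omega)$ be finite-dimensional subspaces, let $Q_H=Q_{H,1}+Q_{H,2}$, let $\tau=T/N>0$ be the time step, and let $\gamma_c,\gamma_a\in(0,1)$ be the constants in the strengthened Cauchy-Schwarz inequalities given in the context. Let $(u_{H,1}^n,p_{H,1}^n)\in V_H\times Q_{H,1}$ and $(u_{H,2}^n,p_{H,2}^n)\in V_H\times Q_{H,2}$, $n=0,1,\dots,N$, be a solution of the partially explicit scheme described in the context, and put $p_H^n=p_{H,1}^n+p_{H,2}^n$. If $$\|q_2\|_b^2\le \frac{1-\gamma_c}{\tau}\,\|q_2\|_c^2\qquad\text{for all } q_2\in Q_{H,2},$$ then the scheme is stable, in the sense that for every $n$ with $1\le n\le N-1$ the following stability estimate holds: $$\sum_{i=1,2}\Big(\gamma_c\|p_{H,i}^{n+1}-p_{H,i}^{n}\|_c^2+\gamma_a\|u_{H,i}^{n+1}-u_{H,i}^{n}\|_a^2\Big)+\tau\|p_H^{n+1}\|_b^2$$ $$\le \sum_{i=1,2}\Big(\gamma_c\|p_{H,i}^{n}-p_{H,i}^{n-1}\|_c^2+\gamma_a\|u_{H,i}^{n}-u_{H,i}^{n-1}\|_a^2\Big)+\tau\|p_H^{n}\|_b^2+\frac{2\tau^2}{1-\gamma_c}\,\|M^{1/2}f^n\|^2 .$$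
   Context: Setting. $\Omega\subset\mathbb{R}^d$, $d\in\{2,3\}$, is a bounded polyhedral Lipschitz domain, $T>0$, $N\in\mathbb{N}$, $\tau=T/N$, $t_n=n\tau$. $(\cdot,\cdot)$ and $\|\cdot\|$ are the inner product and norm of $L^2(\Omega)$. The coefficients are: Lamé coefficients $\lambda,\mu>0$ and permeability $\kappa>0$ (functions of $x$, bounded above and bounded below by positive constants), Biot-Willis coefficient $\alpha$ (a measurable function of $x$ with values in $[0,1]$), and constants $M>0$ (Biot modulus) and $\nu>0$ (viscosity). The source $f$ satisfies $f(t)\in L^2(\Omega)$, and $f^n:=f(t_n)$. Bilinear forms. With $\varepsilon(u)=\frac12(\nabla u+(\nabla u)^T)$ and $\sigma(u)=2\mu\,\varepsilon(u)+\lambda(\nabla\cdot u)\mathcal{I}$ ($\mathcal{I}$ the identity tensor, $:$ the Frobenius inner product), for $u,v\in V=[H_0^1(\Omega)]^d$ and $p,q\in Q=H_0^1(\Omega)$: $$a(u,v)=\int_\Omega\sigma(u):\varepsilon(v)\,dx,\quad b(p,q)=\int_\Omega\frac{\kappa}{\nu}\nabla p\cdot\nabla q\,dx,\quad c(p,q)=\int_\Omega\frac1M\,p\,q\,dx,\quad d(u,q)=\int_\Omega\alpha(\nabla\cdot u)\,q\,dx.$$ Norms: $\|v\|_a^2=a(v,v)$, $\|q\|_b^2=b(q,q)$, $\|q\|_c^2=c(q,q)$. The forms $a$ and $b$ are symmetric and coercive on $V$ and $Q$ respectively. Discrete time derivative: $D_\tau w^{n+1}=(w^{n+1}-w^n)/\tau$.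 Partially explicit scheme. $u_{H,1}^n,u_{H,2}^n\in V_H$, $p_{H,1}^n\in Q_{H,1}$, $p_{H,2}^n\in Q_{H,2}$ ($0\le n\le N$) satisfy, for every time level $0\le m\le N$ and all $v\in V_H$, $$a(u_{H,1}^{m},v)-d(v,p_{H,1}^{m})=0,\qquad a(u_{H,2}^{m},v)-d(v,p_{H,2}^{m})=0,$$ and, for every $1\le n\le N-1$, all $q_1\in Q_{H,1}$ and all $q_2\in Q_{H,2}$, $$d(D_\tau u_{H,1}^{n+1}+D_\tau u_{H,2}^{n},q_1)+c(D_\tau p_{H,1}^{n+1}+D_\tau p_{H,2}^{n},q_1)+b(p_{H,1}^{n+1}+p_{H,2}^{n},q_1)=(f^n,q_1),$$ $$d(D_\tau u_{H,2}^{n+1}+D_\tau u_{H,1}^{n},q_2)+c(D_\tau p_{H,2}^{n+1}+D_\tau p_{H,1}^{n},q_2)+b(p_{H,1}^{n+1}+p_{H,2}^{n},q_2)=(f^n,q_2).$$ Strengthened Cauchy-Schwarz constants. For $i=1,2$ let $U_i$ be the subspace of those $u\in V_H$ for which there is $q\in Q_{H,i}$ with $a(u,v)=d(v,q)$ for all $v\in V_H$ (so $u_{H,i}^n\in U_i$). The constants $0<\gamma_c<1$ and $0<\gamma_a<1$ are such that $$c(p_1,p_2)\le\gamma_c\|p_1\|_c\|p_2\|_c\quad\text{for all }p_1\in Q_{H,1},\ p_2\in Q_{H,2},$$ $$a(u_1,u_2)\le\gamma_a\|u_1\|_a\|u_2\|_a\quad\text{for all }u_1\in U_1,\ u_2\in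 U_2.$$ *)

theory Defs
  imports "HOL-Analysis.Analysis" "HOL-Library.Function_Algebras"
begin

text \<open>The pointwise vector space structure on functions, so that the library's \<open>subspace\<close> and
  \<open>span\<close> apply to sets of functions.\<close>

instantiation "fun" :: (type, real_vector) real_vector
begin

definition scaleR_fun_def: "scaleR r f = (\<lambda>x. r *\<^sub>R f x)"

instance
  by standard (auto simp: scaleR_fun_def fun_eq_iff scaleR_right_distrib scaleR_left_distrib)

end


section \<open>Domains\<close>

text \<open>Near each boundary point, the domain is the strict epigraph of a Lipschitz function of the
  coordinates orthogonal to some unit vector \<open>e\<close>.\<close>

definition lipschitz_domain :: "'a::euclidean_space set \<Rightarrow> bool" where
  "lipschitz_domain \<Omega> \<longleftrightarrow>
     open \<Omega> \<and> connected \<Omega> \<and> \<Omega> \<noteq> {} \<and>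
     (\<forall>x\<in>frontier \<Omega>. \<exists>e r L g. norm e = 1 \<and> r > 0 \<and> lipschitz_on L {z. z \<bullet> e = 0} g \<and>
        \<Omega> \<inter> ball x r = {y \<in> ball x r. g (y - (y \<bullet> e) *\<^sub>R e) < y \<bullet> e})"

text \<open>Polyhedral: the closure is a finite union of convex polytopes. The union need not be
  convex, unlike a \<open>polyhedron\<close> of the library.\<close>

definition bounded_polyhedral_lipschitz_domain :: "'a::euclidean_space set \<Rightarrow> bool" where
  "bounded_polyhedral_lipschitz_domain \<Omega> \<longleftrightarrow>
     lipschitz_domain \<Omega> \<and> bounded \<Omega> \<and>
     (\<exists>\<P>. finite \<P> \<and> (\<forall>P\<in>\<P>. polytope P) \<and> closure \<Omega> = \<Union>\<P>)"


section \<open>Lebesgue and Sobolev spaces\<close>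

text \<open>Elements are functions on the whole space of which only the values almost everywhere in
  \<open>\<Omega>\<close> matter; no quotient is taken.\<close>

definition L2_space :: "'a::euclidean_space set \<Rightarrow> ('a \<Rightarrow> 'b::euclidean_space) set" where
  "L2_space \<Omega> = {f. f \<in> borel_measurable (lebesgue_on \<Omega>) \<and>
                     integrable (lebesgue_on \<Omega>) (\<lambda>x. (norm (f x))\<^sup>2)}"

definition L2_inner ::
    "'a::euclidean_space set \<Rightarrow> ('a \<Rightarrow> 'b::euclidean_space) \<Rightarrow> ('a \<Rightarrow> 'b) \<Rightarrow> real" where
  "L2_inner \<Omega> f g = (LINT x|lebesgue_on \<Omega>. f x \<bullet> g x)"

definition L2_norm :: "'a::euclidean_space set \<Rightarrow> ('a \<Rightarrow> 'b::euclidean_space) \<Rightarrow> real" where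
  "L2_norm \<Omega> f = sqrt (L2_inner \<Omega> f f)"

definition partial_deriv :: "(real^'d \<Rightarrow> real) \<Rightarrow> 'd \<Rightarrow> real^'d \<Rightarrow> real" where
  "partial_deriv f j x = frechet_derivative f (at x) (axis j 1)"

primrec C_k :: "nat \<Rightarrow> (real^'d \<Rightarrow> real) \<Rightarrow> bool" where
  "C_k 0 f \<longleftrightarrow> continuous_on UNIV f"
| "C_k (Suc k) f \<longleftrightarrow> f differentiable_on UNIV \<and> (\<forall>j. C_k k (partial_deriv f j))"

definition test_functions :: "(real^'d) set \<Rightarrow> (real^'d \<Rightarrow> real) set" where
  "test_functions \<Omega> = {\<phi>. (\<forall>k. C_k k \<phi>) \<and>
     compact (closure {x. \<phi> x \<noteq> 0}) \<and> closure {x. \<phi> x \<noteq> 0} \<subseteq> \<Omega>}"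

definition locally_integrable ::
    "'a::euclidean_space set \<Rightarrow> ('a \<Rightarrow> 'b::euclidean_space) \<Rightarrow> bool" where
  "locally_integrable \<Omega> f \<longleftrightarrow> (\<forall>K. compact K \<and> K \<subseteq> \<Omega> \<longrightarrow> set_integrable lebesgue K f)"

definition has_weak_gradient ::
    "(real^'d) set \<Rightarrow> (real^'d \<Rightarrow> real) \<Rightarrow> (real^'d \<Rightarrow> real^'d) \<Rightarrow> bool" where
  "has_weak_gradient \<Omega> f g \<longleftrightarrow>
     locally_integrable \<Omega> f \<and> locally_integrable \<Omega> g \<and>
     (\<forall>\<phi>\<in>test_functions \<Omega>. \<forall>j.
        (LINT x|lebesgue_on \<Omega>. f x * partial_deriv \<phi> j x) =
        - (LINT x|lebesgue_on \<Omega>. g x $ j * \<phi> x))"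

text \<open>A representative of the weak gradient, which is unique up to a null set.\<close>

definition weak_gradient :: "(real^'d) set \<Rightarrow> (real^'d \<Rightarrow> real) \<Rightarrow> real^'d \<Rightarrow> real^'d" where
  "weak_gradient \<Omega> f = (SOME g. has_weak_gradient \<Omega> f g)"

definition H1 :: "(real^'d) set \<Rightarrow> (real^'d \<Rightarrow> real) set" where
  "H1 \<Omega> = {f \<in> L2_space \<Omega>. \<exists>g\<in>L2_space \<Omega>. has_weak_gradient \<Omega> f g}"

definition H1_norm :: "(real^'d) set \<Rightarrow> (real^'d \<Rightarrow> real) \<Rightarrow> real" where
  "H1_norm \<Omega> f = sqrt ((L2_norm \<Omega> f)\<^sup>2 + (L2_norm \<Omega> (weak_gradient \<Omega> f))\<^sup>2)"

text \<open>The closure of the test functions in \<open>H1 \<Omega>\<close>.\<close>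

definition H10 :: "(real^'d) set \<Rightarrow> (real^'d \<Rightarrow> real) set" where
  "H10 \<Omega> = {f \<in> H1 \<Omega>. \<forall>e>0. \<exists>\<phi>\<in>test_functions \<Omega>. H1_norm \<Omega> (f - \<phi>) < e}"

definition H10_vec :: "(real^'d) set \<Rightarrow> (real^'d \<Rightarrow> real^'d) set" where
  "H10_vec \<Omega> = {u. \<forall>i. (\<lambda>x. u x $ i) \<in> H10 \<Omega>}"

text \<open>Finite dimension is required modulo equality almost everywhere, so that \<open>S\<close> may be the span
  of finitely many functions as well as the set of all representatives of such a span.\<close>

definition finite_dim_subspace ::
    "'a::euclidean_space set \<Rightarrow> ('a \<Rightarrow> 'b::real_vector) set \<Rightarrow> bool" where
  "finite_dim_subspace \<Omega> S \<longleftrightarrow> subspace S \<and>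
     (\<exists>B. finite B \<and> B \<subseteq> S \<and>
        (\<forall>f\<in>S. \<exists>g\<in>span B. AE x in lebesgue_on \<Omega>. f x = g x))"


section \<open>Coefficients and bilinear forms\<close>

definition positive_coefficient :: "'a::euclidean_space set \<Rightarrow> ('a \<Rightarrow> real) \<Rightarrow> bool" where
  "positive_coefficient \<Omega> k \<longleftrightarrow> k \<in> borel_measurable (lebesgue_on \<Omega>) \<and>
     (\<exists>lo hi. 0 < lo \<and> (AE x in lebesgue_on \<Omega>. lo \<le> k x \<and> k x \<le> hi))"

definition biot_willis_coefficient :: "'a::euclidean_space set \<Rightarrow> ('a \<Rightarrow> real) \<Rightarrow> bool" where
  "biot_willis_coefficient \<Omega> \<alpha> \<longleftrightarrow> \<alpha> \<in> borel_measurable (lebesgue_on \<Omega>) \<and>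
     (AE x in lebesgue_on \<Omega>. 0 \<le> \<alpha> x \<and> \<alpha> x \<le> 1)"

definition weak_jacobian ::
    "(real^'d) set \<Rightarrow> (real^'d \<Rightarrow> real^'d) \<Rightarrow> real^'d \<Rightarrow> real^'d^'d" where
  "weak_jacobian \<Omega> u x = (\<chi> i. weak_gradient \<Omega> (\<lambda>y. u y $ i) x)"

definition weak_div :: "(real^'d) set \<Rightarrow> (real^'d \<Rightarrow> real^'d) \<Rightarrow> real^'d \<Rightarrow> real" where
  "weak_div \<Omega> u x = trace (weak_jacobian \<Omega> u x)"

definition strain ::
    "(real^'d) set \<Rightarrow> (real^'d \<Rightarrow> real^'d) \<Rightarrow> real^'d \<Rightarrow> real^'d^'d" where
  "strain \<Omega> u x = (1/2) *\<^sub>R (weak_jacobian \<Omega> u x + transpose (weak_jacobian \<Omega> u x))"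

definition stress ::
    "(real^'d) set \<Rightarrow> (real^'d \<Rightarrow> real) \<Rightarrow> (real^'d \<Rightarrow> real) \<Rightarrow> (real^'d \<Rightarrow> real^'d) \<Rightarrow>
     real^'d \<Rightarrow> real^'d^'d" where
  "stress \<Omega> lam \<mu> u x = (2 * \<mu> x) *\<^sub>R strain \<Omega> u x + (lam x * weak_div \<Omega> u x) *\<^sub>R mat 1"

text \<open>On \<open>real^'d^'d\<close>, the inner product \<open>\<bullet>\<close> is the Frobenius inner product.\<close>

definition form_a ::
    "(real^'d) set \<Rightarrow> (real^'d \<Rightarrow> real) \<Rightarrow> (real^'d \<Rightarrow> real) \<Rightarrow>
     (real^'d \<Rightarrow> real^'d) \<Rightarrow> (real^'d \<Rightarrow> real^'d) \<Rightarrow> real" where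
  "form_a \<Omega> lam \<mu> u v = (LINT x|lebesgue_on \<Omega>. stress \<Omega> lam \<mu> u x \<bullet> strain \<Omega> v x)"

definition form_b ::
    "(real^'d) set \<Rightarrow> (real^'d \<Rightarrow> real) \<Rightarrow> real \<Rightarrow>
     (real^'d \<Rightarrow> real) \<Rightarrow> (real^'d \<Rightarrow> real) \<Rightarrow> real" where
  "form_b \<Omega> \<kappa> \<nu> p q =
     (LINT x|lebesgue_on \<Omega>. \<kappa> x / \<nu> * (weak_gradient \<Omega> p x \<bullet> weak_gradient \<Omega> q x))"

definition form_c ::
    "(real^'d) set \<Rightarrow> real \<Rightarrow> (real^'d \<Rightarrow> real) \<Rightarrow> (real^'d \<Rightarrow> real) \<Rightarrow> real" where
  "form_c \<Omega> M p q = (LINT x|lebesgue_on \<Omega>. 1 / M * p x * q x)"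

definition form_d ::
    "(real^'d) set \<Rightarrow> (real^'d \<Rightarrow> real) \<Rightarrow>
     (real^'d \<Rightarrow> real^'d) \<Rightarrow> (real^'d \<Rightarrow> real) \<Rightarrow> real" where
  "form_d \<Omega> \<alpha> u q = (LINT x|lebesgue_on \<Omega>. \<alpha> x * weak_div \<Omega> u x * q x)"

definition form_norm :: "('v \<Rightarrow> 'v \<Rightarrow> real) \<Rightarrow> 'v \<Rightarrow> real" where
  "form_norm B v = sqrt (B v v)"


section \<open>The partially explicit scheme\<close>

text \<open>Used only for \<open>n \<ge> 1\<close>.\<close>

definition D_tau :: "real \<Rightarrow> (nat \<Rightarrow> 'v::real_vector) \<Rightarrow> nat \<Rightarrow> 'v" where
  "D_tau \<tau> w n = (w n - w (n - 1)) /\<^sub>R \<tau>"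

text \<open>\<open>ip\<close> is the inner product for the source term, and \<open>u i n\<close>, \<open>p i n\<close> (\<open>i = 1, 2\<close>) are the
  \<open>i\<close>-th components at time level \<open>n\<close>.\<close>

definition partially_explicit_solution ::
    "('v::real_vector \<Rightarrow> 'v \<Rightarrow> real) \<Rightarrow> ('q::real_vector \<Rightarrow> 'q \<Rightarrow> real) \<Rightarrow> ('q \<Rightarrow> 'q \<Rightarrow> real) \<Rightarrow>
     ('v \<Rightarrow> 'q \<Rightarrow> real) \<Rightarrow> ('q \<Rightarrow> 'q \<Rightarrow> real) \<Rightarrow> real \<Rightarrow> nat \<Rightarrow> (real \<Rightarrow> 'q) \<Rightarrow>
     'v set \<Rightarrow> (nat \<Rightarrow> 'q set) \<Rightarrow> (nat \<Rightarrow> nat \<Rightarrow> 'v) \<Rightarrow> (nat \<Rightarrow> nat \<Rightarrow> 'q) \<Rightarrow> bool" where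
  "partially_explicit_solution a b c d ip \<tau> N f V Q u p \<longleftrightarrow>
     (\<forall>n\<le>N. u 1 n \<in> V \<and> u 2 n \<in> V \<and> p 1 n \<in> Q 1 \<and> p 2 n \<in> Q 2) \<and>
     (\<forall>m\<le>N. \<forall>v\<in>V. a (u 1 m) v - d v (p 1 m) = 0 \<and> a (u 2 m) v - d v (p 2 m) = 0) \<and>
     (\<forall>n\<in>{1..N-1}.
        (\<forall>q\<in>Q 1.
           d (D_tau \<tau> (u 1) (n+1) + D_tau \<tau> (u 2) n) q
           + c (D_tau \<tau> (p 1) (n+1) + D_tau \<tau> (p 2) n) q
           + b (p 1 (n+1) + p 2 n) q = ip (f (real n * \<tau>)) q) \<and>
        (\<forall>q\<in>Q 2.
           d (D_tau \<tau> (u 2) (n+1) + D_tau \<tau> (u 1) n) q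
           + c (D_tau \<tau> (p 2) (n+1) + D_tau \<tau> (p 1) n) q
           + b (p 1 (n+1) + p 2 n) q = ip (f (real n * \<tau>)) q))"

definition elastic_responses ::
    "('v \<Rightarrow> 'v \<Rightarrow> real) \<Rightarrow> ('v \<Rightarrow> 'q \<Rightarrow> real) \<Rightarrow> 'v set \<Rightarrow> 'q set \<Rightarrow> 'v set" where
  "elastic_responses a d V Q = {u\<in>V. \<exists>q\<in>Q. \<forall>v\<in>V. a u v = d v q}"

end

theory Submission
  imports Defs "HOL-Computational_Algebra.Polynomial"
begin

text \<open>The estimate is an energy argument. Testing the \<open>i\<close>-th pressure equation with the increment
  \<open>p i (n+1) - p i n\<close> and using the equilibrium equations to rewrite the coupling form \<open>d\<close> through the
  elastic form \<open>a\<close>, one obtains the squares of all new increments in the norms of \<open>a\<close> and \<open>c\<close>, plus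
  products of a new increment of one component with a lagged increment of the other. The strengthened
  Cauchy-Schwarz inequalities and Young's inequality bound these products by \<open>\<gamma>\<^sub>a\<close> and \<open>\<gamma>\<^sub>c\<close> times the
  mean of the squares; this is why exactly these multiples of the increments propagate from one time
  step to the next. Treating \<open>p 2\<close> explicitly in the diffusion term costs the square of its increment
  in the norm of \<open>b\<close>, and the time step restriction absorbs it into the norm of \<open>c\<close>. What remains of
  the \<open>c\<close> norms pays for the source. The argument is \<open>partially_explicit_energy_estimate\<close>, with
  \<open>energy_balance_arithmetic\<close> for the constants; it is stated for abstract forms, \<open>a\<close>, \<open>b\<close>, \<open>c\<close>
  symmetric and positive semidefinite and \<open>d\<close> bilinear.

  The analytic content lies in showing that the integrals defining the forms have these properties.
  A weak gradient is a choice among functions that agree almost everywhere, so its linearity depends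
  on the uniqueness of weak gradients, \<open>has_weak_gradient_unique\<close>, which in turn rests on
  \<open>fundamental_lemma_of_variations\<close>: a locally integrable function that is orthogonal to all test
  functions vanishes almost everywhere. For that lemma the indicator of an open set is obtained as a
  bounded pointwise limit of smooth functions built from \<open>exp (- 1 / t)\<close>. Once the weak gradient is
  linear up to null sets and square integrable, the same holds for strain and divergence, and products
  of such operators with bounded weights integrate to bilinear forms.\<close>


section \<open>Smooth functions\<close>

lemma C_k_continuous: "C_k k g \<Longrightarrow> continuous_on UNIV g"
  by (cases k) (auto intro: differentiable_imp_continuous_on)

lemma C_k_Suc_imp_C_k: "C_k (Suc k) g \<Longrightarrow> C_k k g"
proof (induction k arbitrary: g)
  case 0
  then show ?case using C_k_continuous by fastforce
next
  case (Suc k)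
  then show ?case by (auto simp del: C_k.simps(1))
qed

lemma partial_deriv_eqI:
  assumes "(g has_derivative g') (at x)"
  shows "partial_deriv g j x = g' (axis j 1)"
  using frechet_derivative_at[OF assms] by (simp add: partial_deriv_def)

text \<open>Derivatives are handled through a chosen family of Frechet derivatives, so that the
  sum, product and chain rules of the library yield the \<open>C_k\<close> closure properties by
  induction on \<open>k\<close>.\<close>

lemma C_k_SucI:
  assumes "\<And>x. (g has_derivative g' x) (at x)"
    and "\<And>j. C_k k (\<lambda>x. g' x (axis j 1))"
  shows "C_k (Suc k) g"
proof -
  have "partial_deriv g j = (\<lambda>x. g' x (axis j 1))" for j
    using partial_deriv_eqI[OF assms(1)] by auto
  moreover have "g differentiable_on UNIV"
    using assms(1) by (auto simp: differentiable_on_def differentiable_def)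
  ultimately show ?thesis using assms(2) by simp
qed

lemma C_k_SucD:
  assumes "C_k (Suc k) g"
  shows "(g has_derivative frechet_derivative g (at x)) (at x)"
    and "C_k k (\<lambda>x. frechet_derivative g (at x) (axis j 1))"
proof -
  show "(g has_derivative frechet_derivative g (at x)) (at x)"
    using assms by (auto simp: differentiable_on_def frechet_derivative_works[symmetric])
  have "(\<lambda>x. frechet_derivative g (at x) (axis j 1)) = partial_deriv g j"
    by (simp add: partial_deriv_def fun_eq_iff)
  then show "C_k k (\<lambda>x. frechet_derivative g (at x) (axis j 1))"
    using assms by simp
qed

lemma C_k_const: "C_k k (\<lambda>x. r)"
proof (induction k arbitrary: r)
  case (Suc k)
  show ?case by (rule C_k_SucI[where g' = "\<lambda>_ _. 0"]) (auto intro!: Suc)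
qed auto

lemma C_k_coordinate: "C_k k (\<lambda>x :: real^'d. x $ i)"
proof (cases k)
  case 0
  then show ?thesis by (auto intro!: continuous_intros)
next
  case (Suc m)
  have "((\<lambda>x. x $ i) has_derivative (\<lambda>h. h $ i)) (at x)" for x :: "real^'d"
    by (rule bounded_linear_imp_has_derivative[OF bounded_linear_vec_nth])
  then show ?thesis
    unfolding Suc by (rule C_k_SucI) (rule C_k_const)
qed

lemma C_k_add: "C_k k g \<Longrightarrow> C_k k h \<Longrightarrow> C_k k (\<lambda>x. g x + h x)"
proof (induction k arbitrary: g h)
  case 0
  then show ?case by (auto intro!: continuous_intros)
next
  case (Suc k)
  show ?case
    by (rule C_k_SucI, rule has_derivative_add[OF C_k_SucD(1)[OF Suc.prems(1)] C_k_SucD(1)[OF Suc.prems(2)]])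
       (intro Suc.IH C_k_SucD(2) Suc.prems)
qed

lemma C_k_mult: "C_k k g \<Longrightarrow> C_k k h \<Longrightarrow> C_k k (\<lambda>x. g x * h x)"
proof (induction k arbitrary: g h)
  case 0
  then show ?case by (auto intro!: continuous_intros)
next
  case (Suc k)
  show ?case
    by (rule C_k_SucI, rule has_derivative_mult[OF C_k_SucD(1)[OF Suc.prems(1)] C_k_SucD(1)[OF Suc.prems(2)]])
       (intro C_k_add Suc.IH C_k_SucD(2) Suc.prems Suc.prems[THEN C_k_Suc_imp_C_k])
qed

lemma C_k_sum: "finite I \<Longrightarrow> (\<And>i. i \<in> I \<Longrightarrow> C_k k (g i)) \<Longrightarrow> C_k k (\<lambda>x. \<Sum>i\<in>I. g i x)"
  by (induction I rule: finite_induct) (auto intro: C_k_const C_k_add)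

text \<open>The outer function comes with the whole sequence of its derivatives: the chain rule
  turns \<open>F m \<circ> g\<close> into \<open>F (Suc m) \<circ> g\<close> times a derivative of
  \<open>g\<close>, so the induction on \<open>k\<close> needs all \<open>m\<close> at once.\<close>

lemma C_k_comp:
  assumes F: "\<And>m t. (F m has_real_derivative F (Suc m) t) (at t)"
    and "C_k k g"
  shows "C_k k (\<lambda>x. F m (g x))"
  using assms(2)
proof (induction k arbitrary: m g)
  case 0
  have "continuous_on UNIV (F m)"
    using F by (meson DERIV_isCont continuous_at_imp_continuous_on)
  then show ?case using 0 by (auto intro: continuous_on_compose2)
next
  case (Suc k)
  have "((\<lambda>x. F m (g x)) has_derivative
      (\<lambda>h. F (Suc m) (g x) * frechet_derivative g (at x) h)) (at x)" for x
    using has_derivative_compose[OF C_k_SucD(1)[OF Suc.prems], of "F m"] F[of m "g x"]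
    by (auto simp: has_field_derivative_def)
  then show ?case
    by (rule C_k_SucI) (intro C_k_mult Suc.IH C_k_SucD(2) Suc.prems Suc.prems[THEN C_k_Suc_imp_C_k])
qed

text \<open>For \<open>P = 1\<close> this is the classical smooth function that is flat at the
  origin. The polynomial factor makes the family closed under differentiation.\<close>

definition flat_exp :: "real poly \<Rightarrow> real \<Rightarrow> real" where
  "flat_exp P t = (if t > 0 then poly P (1 / t) * exp (- 1 / t) else 0)"

lemma power_poly_times_exp_minus_tendsto_0:
  "((\<lambda>s. s ^ n * poly P s * exp (- s)) \<longlongrightarrow> (0::real)) at_top"
proof (induction P arbitrary: n)
  case (pCons r P)
  have "((\<lambda>s. r * (s ^ n / exp s) + s ^ Suc n * poly P s * exp (- s)) \<longlongrightarrow> r * 0 + (0::real)) at_top"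
    by (intro tendsto_intros tendsto_power_div_exp_0 pCons.IH)
  then show ?case
    by (simp add: algebra_simps exp_minus divide_inverse)
qed simp

text \<open>Since \<open>1 / t\<close> has derivative \<open>- 1 / t\<^sup>2\<close>,
  differentiating replaces \<open>P\<close> by \<open>X\<^sup>2 (P - P')\<close>. At the origin
  the difference quotient from the right is a polynomial in \<open>s = 1 / t\<close> times
  \<open>exp (- s)\<close>, which vanishes as \<open>s\<close> grows.\<close>

lemma flat_exp_has_derivative:
  "(flat_exp P has_real_derivative flat_exp ([:0, 0, 1:] * (P - pderiv P)) t) (at t)"
proof (cases t "0 :: real" rule: linorder_cases)
  case less
  have "((\<lambda>_. 0) has_real_derivative 0) (at t)"
    by simp
  then have "(flat_exp P has_real_derivative 0) (at t)"
    by (rule has_field_derivative_transform_within_open[of _ _ _ "{..<0}"])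
       (use less in \<open>auto simp: flat_exp_def\<close>)
  then show ?thesis
    using less by (simp add: flat_exp_def)
next
  case equal
  have "((\<lambda>h. flat_exp P h / h) \<longlongrightarrow> 0) (at_left 0)"
    by (rule tendsto_eventually)
       (auto simp: flat_exp_def eventually_at_filter intro!: always_eventually)
  moreover have "((\<lambda>h. flat_exp P h / h) \<longlongrightarrow> 0) (at_right 0)"
  proof -
    have "((\<lambda>h. inverse h ^ 1 * poly P (inverse h) * exp (- inverse h)) \<longlongrightarrow> (0::real)) (at_right 0)"
      by (rule filterlim_compose[OF power_poly_times_exp_minus_tendsto_0
            filterlim_inverse_at_top_right])
    then show ?thesis
      by (rule Lim_transform_eventually)
         (auto simp: flat_exp_def eventually_at_filter field_simps intro!: always_eventually)
  qed
  ultimately have "((\<lambda>h. flat_exp P h / h) \<longlongrightarrow> 0) (at 0)"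
    by (rule filterlim_split_at)
  then show ?thesis
    by (simp add: equal DERIV_def flat_exp_def)
next
  case greater
  have "((\<lambda>t. poly P (1 / t) * exp (- 1 / t)) has_real_derivative
      flat_exp ([:0, 0, 1:] * (P - pderiv P)) t) (at t)"
    using greater
    by (auto intro!: derivative_eq_intros simp: flat_exp_def field_simps power2_eq_square)
  then show ?thesis
    by (rule has_field_derivative_transform_within_open[of _ _ _ "{0<..}"])
       (use greater in \<open>auto simp: flat_exp_def\<close>)
qed

abbreviation smooth_step :: "real \<Rightarrow> real" where
  "smooth_step \<equiv> flat_exp 1"

lemma C_k_smooth_step:
  assumes "C_k k g"
  shows "C_k k (\<lambda>x. smooth_step (g x))"
proof -
  define F where "F m = flat_exp (((\<lambda>P. [:0, 0, 1:] * (P - pderiv P)) ^^ m) 1)" for m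
  have "(F m has_real_derivative F (Suc m) t) (at t)" for m t
    unfolding F_def using flat_exp_has_derivative by simp
  from C_k_comp[of F, OF this assms, of 0] show ?thesis
    by (simp add: F_def)
qed

lemma smooth_step_bounds: "0 \<le> smooth_step t" "smooth_step t \<le> 1"
  by (auto simp: flat_exp_def)

lemma smooth_step_tendsto_1:
  assumes "filterlim g at_top F"
  shows "((\<lambda>x. smooth_step (g x)) \<longlongrightarrow> 1) F"
proof -
  have "((\<lambda>t. exp (- inverse t)) \<longlongrightarrow> exp (- (0::real))) at_top"
    by (intro tendsto_intros tendsto_inverse_0_at_top filterlim_ident)
  then have "((\<lambda>t. exp (- inverse t)) \<longlongrightarrow> (1::real)) at_top" by simp
  then have "(smooth_step \<longlongrightarrow> 1) at_top"
    by (rule Lim_transform_eventually)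
       (auto intro: eventually_mono[OF eventually_gt_at_top[of 0]] simp: flat_exp_def field_simps)
  then show ?thesis
    using assms by (rule filterlim_compose)
qed

lemma smooth_bump_on_ball:
  fixes z :: "real^'d"
  obtains \<psi> where "\<And>k. C_k k \<psi>" "\<And>x. 0 \<le> \<psi> x" "\<And>x. \<psi> x > 0 \<longleftrightarrow> x \<in> ball z r"
proof (cases "r > 0")
  case True
  \<comment> \<open>The difference \<open>r\<^sup>2 - (dist z x)\<^sup>2\<close>, spelled out with sums and products only, as the
    closure rules for \<open>C_k\<close> require.\<close>
  have eq: "r\<^sup>2 + - (\<Sum>i\<in>UNIV. (x $ i + - z $ i) * (x $ i + - z $ i)) = r\<^sup>2 - (dist z x)\<^sup>2" for x
    unfolding dist_commute[of z x]
    by (simp add: dist_norm norm_vec_def L2_set_def sum_nonneg flip: power2_eq_square)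
  show thesis
  proof (rule that)
    show "C_k k (\<lambda>x. smooth_step (r\<^sup>2 + -1 * (\<Sum>i\<in>UNIV. (x $ i + - z $ i) * (x $ i + - z $ i))))" for k
      by (intro C_k_smooth_step C_k_add C_k_const C_k_sum C_k_mult C_k_coordinate) auto
    show "0 \<le> smooth_step (r\<^sup>2 + -1 * (\<Sum>i\<in>UNIV. (x $ i + - z $ i) * (x $ i + - z $ i)))" for x
      by (rule smooth_step_bounds)
    show "smooth_step (r\<^sup>2 + -1 * (\<Sum>i\<in>UNIV. (x $ i + - z $ i) * (x $ i + - z $ i))) > 0
        \<longleftrightarrow> x \<in> ball z r" for x
      using True eq[of x] power2_less_imp_less[of "dist z x" r] power_strict_mono[of "dist z x" r 2]
      by (auto simp: flat_exp_def)
  qed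
next
  case False
  then show thesis
    by (intro that[of "\<lambda>_. 0"]) (auto intro: C_k_const dest: le_less_trans[OF zero_le_dist])
qed


section \<open>The fundamental lemma of the calculus of variations\<close>

text \<open>Lindelof's theorem, with the balls listed as a sequence. A finite or empty cover is
  padded with empty balls, whence the disjunction in the conclusion.\<close>

lemma countable_union_of_balls:
  fixes U :: "'a::euclidean_space set"
  assumes U: "open U" and P: "\<And>x. x \<in> U \<Longrightarrow> \<exists>r>0. P x r \<and> ball x r \<subseteq> U"
  obtains z r where "(\<Union>k::nat. ball (z k) (r k)) = U"
    and "\<And>k. ball (z k) (r k) = {} \<or> P (z k) (r k)"
proof -
  define \<B> where "\<B> = {ball x r |x r. x \<in> U \<and> r > 0 \<and> P x r \<and> ball x r \<subseteq> U}"
  obtain \<C> where \<C>: "\<C> \<subseteq> \<B>" "countable \<C>" "\<Union>\<C> = \<Union>\<B>"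
    using Lindelof[of \<B>] by (auto simp: \<B>_def)
  have "\<Union>\<B> = U"
  proof
    show "\<Union>\<B> \<subseteq> U" by (auto simp: \<B>_def)
    show "U \<subseteq> \<Union>\<B>"
    proof
      fix x assume x: "x \<in> U"
      with P obtain r where r: "r > 0" "P x r" "ball x r \<subseteq> U" by blast
      then have "ball x r \<in> \<B>" using x unfolding \<B>_def by blast
      moreover have "x \<in> ball x r" using r by simp
      ultimately show "x \<in> \<Union>\<B>" by blast
    qed
  qed
  define S where "S = from_nat_into (insert {} \<C>)"
  have S: "range S = insert {} \<C>"
    unfolding S_def using \<C>(2) by (intro range_from_nat_into) auto
  have "\<exists>x r. ball x r = S k \<and> (ball x r = {} \<or> P x r)" for k
  proof (cases "S k = {}")
    case True
    then show ?thesis by (intro exI[of _ 0]) auto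
  next
    case False
    then have "S k \<in> \<B>" using S \<C>(1) by blast
    then show ?thesis by (auto simp: \<B>_def)
  qed
  then obtain z r where zr: "\<And>k. ball (z k) (r k) = S k \<and> (ball (z k) (r k) = {} \<or> P (z k) (r k))"
    by metis
  show thesis
  proof (rule that)
    show "(\<Union>k. ball (z k) (r k)) = U"
      using zr S \<open>\<Union>\<C> = \<Union>\<B>\<close> \<open>\<Union>\<B> = U\<close> by simp
    show "ball (z k) (r k) = {} \<or> P (z k) (r k)" for k
      using zr by blast
  qed
qed

lemma countable_union_of_inner_balls:
  fixes \<Omega> :: "'a::euclidean_space set"
  assumes \<Omega>: "open \<Omega>"
  obtains z r where "(\<Union>k::nat. ball (z k) (r k)) = \<Omega>"
    and "\<And>k. ball (z k) (r k) = {} \<or> cball (z k) (r k) \<subseteq> \<Omega>"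
proof (rule countable_union_of_balls[OF \<Omega>, of "\<lambda>x r. cball x r \<subseteq> \<Omega>"])
  show "\<exists>r>0. cball x r \<subseteq> \<Omega> \<and> ball x r \<subseteq> \<Omega>" if "x \<in> \<Omega>" for x
    using \<Omega> that open_contains_cball ball_subset_cball by (metis order_trans)
qed (rule that)

text \<open>Write \<open>U\<close> as a union of balls with bumps \<open>\<psi> k\<close>. On
  \<open>U\<close> the numbers \<open>n * (\<Sum>k<n. \<psi> k x)\<close> tend to infinity, off
  \<open>U\<close> they are zero, and a smooth step sends infinity to one and zero to zero. The
  partial sums, finite at each stage, keep the approximants smooth.\<close>

lemma smooth_approximation_of_open_set:
  fixes U :: "(real^'d) set"
  assumes "open U"
  obtains \<phi> :: "nat \<Rightarrow> real^'d \<Rightarrow> real" where "\<And>n k. C_k k (\<phi> n)"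
    "\<And>n x. 0 \<le> \<phi> n x" "\<And>n x. \<phi> n x \<le> 1" "\<And>n x. x \<notin> U \<Longrightarrow> \<phi> n x = 0"
    "\<And>x. x \<in> U \<Longrightarrow> (\<lambda>n. \<phi> n x) \<longlonglongrightarrow> 1"
proof -
  obtain z :: "nat \<Rightarrow> real^'d" and r where U: "(\<Union>k. ball (z k) (r k)) = U"
    by (rule countable_union_of_balls[OF assms, of "\<lambda>_ _. True"])
       (use assms open_contains_ball in blast)+
  have "\<forall>k. \<exists>\<psi>. (\<forall>j. C_k j \<psi>) \<and> (\<forall>x. 0 \<le> \<psi> x) \<and> (\<forall>x. \<psi> x > 0 \<longleftrightarrow> x \<in> ball (z k) (r k))"
    using smooth_bump_on_ball by metis
  then obtain \<psi> where \<psi>: "\<And>k j. C_k j (\<psi> k)" "\<And>k x. 0 \<le> \<psi> k x"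
    "\<And>k x. \<psi> k x > 0 \<longleftrightarrow> x \<in> ball (z k) (r k)"
    by metis
  define \<phi> where "\<phi> n x = smooth_step (real n * (\<Sum>k<n. \<psi> k x))" for n x
  show thesis
  proof (rule that[of \<phi>])
    show "C_k k (\<phi> n)" for n k
      unfolding \<phi>_def by (intro C_k_smooth_step C_k_mult C_k_const C_k_sum \<psi>) auto
    show "\<phi> n x = 0" if "x \<notin> U" for n x
    proof -
      have "\<psi> k x = 0" for k
        using \<psi>(2,3)[of k x] U that by (auto simp: order.order_iff_strict)
      then show ?thesis by (simp add: \<phi>_def flat_exp_def)
    qed
    show "(\<lambda>n. \<phi> n x) \<longlonglongrightarrow> 1" if "x \<in> U" for x
    proof -
      obtain m where "x \<in> ball (z m) (r m)" using U \<open>x \<in> U\<close> by blast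
      then have m: "\<psi> m x > 0" by (simp only: \<psi>(3))
      have lim: "filterlim (\<lambda>n. real n * \<psi> m x) at_top sequentially"
        using filterlim_tendsto_pos_mult_at_top[OF tendsto_const m filterlim_real_sequentially]
        by (simp add: mult.commute)
      have "eventually (\<lambda>n. real n * \<psi> m x \<le> real n * (\<Sum>k<n. \<psi> k x)) sequentially"
        using eventually_gt_at_top[of m]
      proof eventually_elim
        case (elim n)
        have "\<psi> m x \<le> (\<Sum>k<n. \<psi> k x)"
          by (rule member_le_sum[where f = "\<lambda>k. \<psi> k x"]) (use elim \<psi>(2) in auto)
        then show ?case by (rule mult_left_mono) simp
      qed
      from filterlim_at_top_mono[OF lim this] show ?thesis
        unfolding \<phi>_def by (rule smooth_step_tendsto_1)
    qed
  qed (auto simp: \<phi>_def smooth_step_bounds)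
qed

lemma integral_lebesgue_on:
  fixes g :: "'a::euclidean_space \<Rightarrow> 'b::euclidean_space"
  assumes "\<Omega> \<in> sets lebesgue"
  shows "(LINT x|lebesgue_on \<Omega>. g x) = (LINT x|lebesgue. indicator \<Omega> x *\<^sub>R g x)"
    and "integrable (lebesgue_on \<Omega>) g \<longleftrightarrow> integrable lebesgue (\<lambda>x. indicator \<Omega> x *\<^sub>R g x)"
  using assms by (simp_all add: integral_restrict_space integrable_restrict_space)

text \<open>Dominated convergence along the smooth approximation of \<open>U\<close>; the compact
  set \<open>K\<close> carries the dominating function and keeps the supports inside
  \<open>\<Omega>\<close>.\<close>

lemma integral_open_subset_eq_0:
  fixes h :: "real^'d \<Rightarrow> real"
  assumes \<Omega>: "open \<Omega>" and h: "locally_integrable \<Omega> h"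
    and 0: "\<And>\<phi>. \<phi> \<in> test_functions \<Omega> \<Longrightarrow> (LINT x|lebesgue_on \<Omega>. h x * \<phi> x) = 0"
    and U: "open U" "U \<subseteq> K" and K: "compact K" "K \<subseteq> \<Omega>"
  shows "(LINT x:U|lebesgue. h x) = 0"
proof -
  obtain \<phi> :: "nat \<Rightarrow> real^'d \<Rightarrow> real" where \<phi>: "\<And>n k. C_k k (\<phi> n)"
    "\<And>n x. 0 \<le> \<phi> n x" "\<And>n x. \<phi> n x \<le> 1" "\<And>n x. x \<notin> U \<Longrightarrow> \<phi> n x = 0"
    "\<And>x. x \<in> U \<Longrightarrow> (\<lambda>n. \<phi> n x) \<longlonglongrightarrow> 1"
    using smooth_approximation_of_open_set[OF U(1)] by blast
  have hK: "integrable lebesgue (\<lambda>x. indicator K x *\<^sub>R h x)"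
    using h K by (auto simp: locally_integrable_def set_integrable_def)
  have supp: "closure {x. \<phi> n x \<noteq> 0} \<subseteq> K" for n
    using \<phi>(4) U(2) K(1) by (intro closure_minimal) (auto intro: compact_imp_closed)
  have "compact (closure {x. \<phi> n x \<noteq> 0})" for n
    using compact_Int_closed[OF K(1) closed_closure, of "{x. \<phi> n x \<noteq> 0}"] supp[of n]
    by (simp add: Int_absorb1)
  then have "\<phi> n \<in> test_functions \<Omega>" for n
    using \<phi>(1) supp K(2) unfolding test_functions_def by blast
  then have "0 = (LINT x|lebesgue_on \<Omega>. h x * \<phi> n x)" for n
    using 0 by simp
  also have "(LINT x|lebesgue_on \<Omega>. h x * \<phi> n x) = (LINT x|lebesgue. (indicator K x *\<^sub>R h x) * \<phi> n x)" for n
  proof -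
    have "indicator \<Omega> x *\<^sub>R (h x * \<phi> n x) = (indicator K x *\<^sub>R h x) * \<phi> n x" for x
      using \<phi>(4)[of x n] U K by (auto simp: indicator_def)
    then show ?thesis
      using \<Omega> by (simp only: integral_lebesgue_on(1) borel_open sets_completionI_sets sets_lborel)
  qed
  finally have eq: "(LINT x|lebesgue. (indicator K x *\<^sub>R h x) * \<phi> n x) = 0" for n
    by simp
  have "(\<lambda>n. LINT x|lebesgue. (indicator K x *\<^sub>R h x) * \<phi> n x)
      \<longlonglongrightarrow> (LINT x|lebesgue. indicator U x *\<^sub>R h x)"
  proof (rule integral_dominated_convergence[where w = "\<lambda>x. norm (indicator K x *\<^sub>R h x)"])
    have meas: "(\<lambda>x. indicator K x *\<^sub>R h x) \<in> borel_measurable lebesgue"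
      using hK by simp
    have \<phi>m: "\<phi> n \<in> borel_measurable lebesgue" for n
      using C_k_continuous[OF \<phi>(1)]
      by (intro borel_measurable_if_lebesgue_on measurable_completion) (simp add: borel_measurable_continuous_onI)
    show "(\<lambda>x. (indicator K x *\<^sub>R h x) * \<phi> n x) \<in> borel_measurable lebesgue" for n
      using meas \<phi>m by (rule borel_measurable_times)
    have "(\<lambda>x. indicator U x *\<^sub>R (indicator K x *\<^sub>R h x)) \<in> borel_measurable lebesgue"
      using U(1) by (intro borel_measurable_scaleR borel_measurable_indicator meas) auto
    also have "(\<lambda>x. indicator U x *\<^sub>R (indicator K x *\<^sub>R h x)) = (\<lambda>x. indicator U x *\<^sub>R h x)"
      using U(2) by (auto simp: indicator_def fun_eq_iff)
    finally show "(\<lambda>x. indicator U x *\<^sub>R h x) \<in> borel_measurable lebesgue" .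
    show "integrable lebesgue (\<lambda>x. norm (indicator K x *\<^sub>R h x))"
      using hK by (rule integrable_norm)
    show "AE x in lebesgue. (\<lambda>n. (indicator K x *\<^sub>R h x) * \<phi> n x) \<longlonglongrightarrow> indicator U x *\<^sub>R h x"
    proof (rule AE_I2)
      fix x
      show "(\<lambda>n. (indicator K x *\<^sub>R h x) * \<phi> n x) \<longlonglongrightarrow> indicator U x *\<^sub>R h x"
      proof (cases "x \<in> U")
        case True
        then show ?thesis
          using tendsto_mult_left[OF \<phi>(5)[OF True], of "h x"] U(2) by (auto simp: indicator_def)
      qed (simp add: \<phi>(4))
    qed
    show "AE x in lebesgue. norm ((indicator K x *\<^sub>R h x) * \<phi> n x) \<le> norm (indicator K x *\<^sub>R h x)" for n
      using \<phi>(2,3) by (intro AE_I2) (auto simp: abs_mult intro!: mult_left_le)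
  qed
  then show ?thesis
    unfolding eq set_lebesgue_integral_def by (simp add: LIMSEQ_const_iff)
qed

text \<open>The integral over a closed subset of \<open>B\<close> is the difference of the
  integrals over two open sets, hence zero. If such a set lies in \<open>{h > 0}\<close> it is
  therefore null, and up to a null set \<open>{h > 0}\<close> is a countable union of closed sets.\<close>

lemma AE_nonpos_if_integral_open_eq_0:
  fixes h :: "'a::euclidean_space \<Rightarrow> real"
  assumes B: "open B" "set_integrable lebesgue B h"
    and 0: "\<And>U. open U \<Longrightarrow> U \<subseteq> B \<Longrightarrow> (LINT x:U|lebesgue. h x) = 0"
  shows "AE x in lebesgue. x \<in> B \<longrightarrow> h x \<le> 0"
proof -
  have meas: "(\<lambda>x. indicator B x *\<^sub>R h x) \<in> borel_measurable lebesgue"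
    using B by (auto simp: set_integrable_def)
  define P where "P = {x. indicator B x *\<^sub>R h x > 0}"
  have P_iff: "x \<in> P \<longleftrightarrow> x \<in> B \<and> h x > 0" for x
    by (cases "x \<in> B") (auto simp: P_def)
  have P: "P \<in> sets lebesgue"
    using borel_measurable_less[OF borel_measurable_const[of 0] meas] by (simp add: P_def pred_def)
  obtain C T where CT: "fsigma C" "T \<in> null_sets lebesgue" "C \<union> T = P"
    using lebesgue_set_almost_fsigma[OF P] by blast
  have null: "F \<in> null_sets lebesgue" if F: "closed F" "F \<subseteq> P" for F
  proof -
    have FB: "F \<subseteq> B" "\<And>x. x \<in> F \<Longrightarrow> h x > 0"
      using F(2) P_iff by auto
    have Fint: "set_integrable lebesgue F h"
      by (rule set_integrable_subset[OF B(2)]) (use F(1) FB in auto)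
    have "0 = (LINT x:B|lebesgue. h x)"
      using 0[of B] B(1) by simp
    also have "\<dots> = (LINT x:(B - F) \<union> F|lebesgue. h x)"
      using FB by (simp add: Un_absorb2)
    also have "\<dots> = (LINT x:B - F|lebesgue. h x) + (LINT x:F|lebesgue. h x)"
      by (rule set_integral_Un) (use Fint B F in \<open>auto intro: set_integrable_subset[OF B(2)]\<close>)
    also have "(LINT x:B - F|lebesgue. h x) = 0"
      using B(1) F(1) by (intro 0) auto
    finally have "(LINT x|lebesgue. indicator F x *\<^sub>R h x) = 0"
      by (simp add: set_lebesgue_integral_def)
    then have "AE x in lebesgue. indicator F x *\<^sub>R h x = 0"
      using Fint FB(2) by (subst (asm) integral_nonneg_eq_0_iff_AE)
        (auto simp: set_integrable_def indicator_def intro!: AE_I2 less_imp_le)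
    then have "AE x in lebesgue. x \<notin> F"
      by eventually_elim (use FB(2) in force)
    then show ?thesis
      using F(1) by (subst AE_iff_null_sets) auto
  qed
  obtain F :: "nat \<Rightarrow> 'a set" where F: "range F \<subseteq> Collect compact" "C = \<Union>(range F)"
    using CT(1) by (auto simp: fsigma_Union_compact)
  have "F n \<in> null_sets lebesgue" for n
    using F CT(3) by (intro null) (auto intro: compact_imp_closed)
  then have "C \<in> null_sets lebesgue"
    unfolding F(2) by (rule null_sets_UN)
  then have "P \<in> null_sets lebesgue"
    using CT by (metis null_sets.Un)
  then have "AE x in lebesgue. x \<notin> P"
    by (rule AE_not_in)
  then show ?thesis
    by eventually_elim (auto simp: P_iff not_less)
qed

text \<open>The integrals over open subsets of a compactly contained ball vanish, so the one-sided
  lemma applies to both signs; countably many such balls cover \<open>\<Omega>\<close>.\<close>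

theorem fundamental_lemma_of_variations:
  fixes h :: "real^'d \<Rightarrow> real"
  assumes \<Omega>: "open \<Omega>" and h: "locally_integrable \<Omega> h"
    and 0: "\<And>\<phi>. \<phi> \<in> test_functions \<Omega> \<Longrightarrow> (LINT x|lebesgue_on \<Omega>. h x * \<phi> x) = 0"
  shows "AE x in lebesgue_on \<Omega>. h x = 0"
proof -
  obtain z :: "nat \<Rightarrow> real^'d" and r where \<Omega>_eq: "(\<Union>k. ball (z k) (r k)) = \<Omega>"
    and sub: "\<And>k. ball (z k) (r k) = {} \<or> cball (z k) (r k) \<subseteq> \<Omega>"
    using countable_union_of_inner_balls[OF \<Omega>] by blast
  have "AE x in lebesgue. x \<in> ball (z k) (r k) \<longrightarrow> h x = 0" for k
  proof (cases "ball (z k) (r k) = {}")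
    case False
    let ?B = "ball (z k) (r k)" and ?K = "cball (z k) (r k)"
    have K: "compact ?K" "?K \<subseteq> \<Omega>" "?B \<subseteq> ?K" using sub False by auto
    have int: "set_integrable lebesgue ?B h"
      by (rule set_integrable_subset[of _ ?K]) (use h K in \<open>auto simp: locally_integrable_def\<close>)
    have 1: "(LINT x:U|lebesgue. h x) = 0" if "open U" "U \<subseteq> ?B" for U
      using integral_open_subset_eq_0[OF \<Omega> h 0 that(1) _ K(1,2)] that(2) K(3) by blast
    have "AE x in lebesgue. x \<in> ?B \<longrightarrow> h x \<le> 0"
      by (rule AE_nonpos_if_integral_open_eq_0[OF _ int 1]) auto
    moreover have "AE x in lebesgue. x \<in> ?B \<longrightarrow> - h x \<le> 0"
    proof (rule AE_nonpos_if_integral_open_eq_0)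
      show "set_integrable lebesgue ?B (\<lambda>x. - h x)"
        using int by (simp add: set_integrable_def)
      show "(LINT x:U|lebesgue. - h x) = 0" if "open U" "U \<subseteq> ?B" for U
        using 1[OF that] by (simp add: set_lebesgue_integral_def)
    qed auto
    ultimately show ?thesis
      by eventually_elim auto
  next
    case True
    show ?thesis unfolding True by simp
  qed
  then have "AE x in lebesgue. \<forall>k. x \<in> ball (z k) (r k) \<longrightarrow> h x = 0"
    unfolding AE_all_countable by blast
  then have "AE x in lebesgue. x \<in> \<Omega> \<longrightarrow> h x = 0"
    by eventually_elim (use \<Omega>_eq in blast)
  then show ?thesis
    using \<Omega> by (subst AE_restrict_space_iff) auto
qed


section \<open>Weak gradients\<close>

text \<open>Measurability is local, and \<open>g\<close> is integrable on each ball of a countable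
  cover by compactly contained balls. This makes every weak gradient measurable, including one
  picked by the choice operator.\<close>

lemma locally_integrable_borel_measurable:
  fixes g :: "'a::euclidean_space \<Rightarrow> 'b::euclidean_space"
  assumes \<Omega>: "open \<Omega>" and g: "locally_integrable \<Omega> g"
  shows "g \<in> borel_measurable (lebesgue_on \<Omega>)"
proof -
  obtain z :: "nat \<Rightarrow> 'a" and r where \<Omega>_eq: "(\<Union>k. ball (z k) (r k)) = \<Omega>"
    and sub: "\<And>k. ball (z k) (r k) = {} \<or> cball (z k) (r k) \<subseteq> \<Omega>"
    using countable_union_of_inner_balls[OF \<Omega>] by blast
  define B where "B k = ball (z k) (r k)" for k
  have B_Union: "(\<Union>k. B k) = \<Omega>"
    unfolding B_def by (rule \<Omega>_eq)
  then have B: "B k \<subseteq> \<Omega>" for k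
    by blast
  have B_open: "open (B k)" for k
    by (simp add: B_def)
  have "g \<in> borel_measurable (lebesgue_on (B k))" for k
  proof -
    have "set_integrable lebesgue (B k) g"
    proof (cases "B k = {}")
      case False
      then have "cball (z k) (r k) \<subseteq> \<Omega>"
        using sub[of k] unfolding B_def by blast
      then have "set_integrable lebesgue (cball (z k) (r k)) g"
        using g compact_cball unfolding locally_integrable_def by blast
      then show ?thesis
        by (rule set_integrable_subset) (use B_open[of k] in \<open>simp_all add: B_def ball_subset_cball\<close>)
    qed (simp add: set_integrable_def)
    then have "(\<lambda>x. indicator (B k) x *\<^sub>R g x) \<in> borel_measurable lebesgue"
      unfolding set_integrable_def by (rule borel_measurable_integrable)
    then show ?thesis
      using B_open[of k] by (subst borel_measurable_restrict_space_iff) auto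
  qed
  moreover have "restrict_space (lebesgue_on \<Omega>) (B k) = lebesgue_on (B k)" for k
    using B[of k] B_open[of k] \<Omega> by (subst restrict_restrict_space) (simp_all add: Int_absorb1)
  moreover have "B k \<inter> space (lebesgue_on \<Omega>) \<in> sets (lebesgue_on \<Omega>)" for k
    using B[of k] B_open[of k] \<Omega> by (simp add: sets_restrict_space_iff Int_absorb2)
  ultimately have *: "S \<inter> space (lebesgue_on \<Omega>) \<in> sets (lebesgue_on \<Omega>)"
    "g \<in> borel_measurable (restrict_space (lebesgue_on \<Omega>) S)" if "S \<in> range B" for S
    using that by (elim imageE; simp only:)+
  show ?thesis
    by (rule measurable_piecewise_restrict[OF _ *(1) _ *(2)]) (simp_all add: B_Union)
qed

lemma integrable_times_continuous:
  fixes h :: "'a::euclidean_space \<Rightarrow> real"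
  assumes \<Omega>: "open \<Omega>" and h: "locally_integrable \<Omega> h"
    and \<psi>: "continuous_on UNIV \<psi>" and K: "compact K" "K \<subseteq> \<Omega>" "\<And>x. x \<notin> K \<Longrightarrow> \<psi> x = 0"
  shows "integrable (lebesgue_on \<Omega>) (\<lambda>x. h x * \<psi> x)"
proof -
  have hK: "integrable lebesgue (\<lambda>x. indicator K x *\<^sub>R h x)"
    using h K by (auto simp: locally_integrable_def set_integrable_def)
  have "bounded (\<psi> ` K)"
    using \<psi> K(1) by (intro compact_imp_bounded compact_continuous_image) (auto intro: continuous_on_subset)
  then obtain C where C: "\<And>x. x \<in> K \<Longrightarrow> \<bar>\<psi> x\<bar> \<le> C"
    by (auto simp: bounded_iff)
  have "integrable lebesgue (\<lambda>x. (indicator K x *\<^sub>R h x) * \<psi> x)"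
  proof (rule Bochner_Integration.integrable_bound)
    show "integrable lebesgue (\<lambda>x. C * (indicator K x *\<^sub>R h x))"
      using hK by (rule integrable_mult_right)
    have "\<psi> \<in> borel_measurable lebesgue"
      using \<psi> by (intro measurable_completion) (simp add: borel_measurable_continuous_onI)
    then show "(\<lambda>x. (indicator K x *\<^sub>R h x) * \<psi> x) \<in> borel_measurable lebesgue"
      using borel_measurable_integrable[OF hK] by (intro borel_measurable_times)
    show "AE x in lebesgue. norm ((indicator K x *\<^sub>R h x) * \<psi> x) \<le> norm (C * (indicator K x *\<^sub>R h x))"
    proof (rule AE_I2)
      fix x
      show "norm ((indicator K x *\<^sub>R h x) * \<psi> x) \<le> norm (C * (indicator K x *\<^sub>R h x))"
        using C[of x] mult_right_mono[of "\<bar>\<psi> x\<bar>" "\<bar>C\<bar>" "\<bar>h x\<bar>"]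
        by (cases "x \<in> K") (auto simp: abs_mult mult.commute)
    qed
  qed
  also have "(\<lambda>x. (indicator K x *\<^sub>R h x) * \<psi> x) = (\<lambda>x. indicator \<Omega> x *\<^sub>R (h x * \<psi> x))"
    using K by (force simp: indicator_def fun_eq_iff)
  finally show ?thesis
    using \<Omega> by (subst integral_lebesgue_on(2)) auto
qed

lemma integrable_times_test_function:
  fixes h :: "real^'d \<Rightarrow> real"
  assumes \<Omega>: "open \<Omega>" and h: "locally_integrable \<Omega> h" and \<phi>: "\<phi> \<in> test_functions \<Omega>"
  shows "integrable (lebesgue_on \<Omega>) (\<lambda>x. h x * \<phi> x)"
    and "integrable (lebesgue_on \<Omega>) (\<lambda>x. h x * partial_deriv \<phi> j x)"
proof -
  let ?K = "closure {x. \<phi> x \<noteq> 0}"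
  have K: "compact ?K" "?K \<subseteq> \<Omega>" and C: "\<And>k. C_k k \<phi>"
    using \<phi> by (auto simp: test_functions_def)
  have 0: "\<phi> x = 0" if "x \<notin> ?K" for x
    using that closure_subset[of "{x. \<phi> x \<noteq> 0}"] by auto
  show "integrable (lebesgue_on \<Omega>) (\<lambda>x. h x * \<phi> x)"
    by (rule integrable_times_continuous[OF \<Omega> h C_k_continuous[OF C] K 0])
  have zero_deriv: "partial_deriv \<phi> j x = 0" if x: "x \<notin> ?K" for x
  proof -
    have "(\<phi> has_derivative (\<lambda>_. 0)) (at x)"
    proof (rule has_derivative_transform_within_open)
      show "((\<lambda>_. 0) has_derivative (\<lambda>_. 0)) (at x)" by simp
      show "open (- ?K)" "x \<in> - ?K" using x by (simp_all add: open_Compl)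
      show "0 = \<phi> y" if "y \<in> - ?K" for y using 0[of y] that by simp
    qed
    then show ?thesis by (simp add: partial_deriv_eqI)
  qed
  have "continuous_on UNIV (partial_deriv \<phi> j)"
    using C[of "Suc 0"] by simp
  then show "integrable (lebesgue_on \<Omega>) (\<lambda>x. h x * partial_deriv \<phi> j x)"
    using K zero_deriv by (rule integrable_times_continuous[OF \<Omega> h])
qed

lemma locally_integrable_add:
  "locally_integrable \<Omega> g \<Longrightarrow> locally_integrable \<Omega> h \<Longrightarrow> locally_integrable \<Omega> (\<lambda>x. g x + h x)"
  unfolding locally_integrable_def by (intro allI impI set_integral_add(1)) simp_all

lemma locally_integrable_bounded_linear:
  assumes "bounded_linear L" "locally_integrable \<Omega> g"
  shows "locally_integrable \<Omega> (\<lambda>x. L (g x))"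
  unfolding locally_integrable_def set_integrable_def
proof (intro allI impI)
  fix K assume "compact K \<and> K \<subseteq> \<Omega>"
  then have "integrable lebesgue (\<lambda>x. indicator K x *\<^sub>R g x)"
    using assms(2) unfolding locally_integrable_def set_integrable_def by blast
  then have "integrable lebesgue (\<lambda>x. L (indicator K x *\<^sub>R g x))"
    by (rule integrable_bounded_linear[OF assms(1)])
  then show "integrable lebesgue (\<lambda>x. indicator K x *\<^sub>R L (g x))"
    unfolding linear_scale[OF bounded_linear.linear[OF assms(1)]] .
qed

lemmas locally_integrable_nth = locally_integrable_bounded_linear[OF bounded_linear_vec_nth]
lemmas locally_integrable_scaleR = locally_integrable_bounded_linear[OF bounded_linear_scaleR_right]

lemma has_weak_gradient_add:
  assumes \<Omega>: "open \<Omega>" and f: "has_weak_gradient \<Omega> f f'" and g: "has_weak_gradient \<Omega> g g'"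
  shows "has_weak_gradient \<Omega> (\<lambda>x. f x + g x) (\<lambda>x. f' x + g' x)"
proof -
  have loc: "locally_integrable \<Omega> f" "locally_integrable \<Omega> f'" "locally_integrable \<Omega> g" "locally_integrable \<Omega> g'"
    using f g unfolding has_weak_gradient_def by blast+
  have "(LINT x|lebesgue_on \<Omega>. (f x + g x) * partial_deriv \<phi> j x)
      = - (LINT x|lebesgue_on \<Omega>. (f' x + g' x) $ j * \<phi> x)" if \<phi>: "\<phi> \<in> test_functions \<Omega>" for \<phi> j
  proof -
    have "(LINT x|lebesgue_on \<Omega>. (f x + g x) * partial_deriv \<phi> j x)
        = (LINT x|lebesgue_on \<Omega>. f x * partial_deriv \<phi> j x) + (LINT x|lebesgue_on \<Omega>. g x * partial_deriv \<phi> j x)"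
      unfolding distrib_right
      by (intro Bochner_Integration.integral_add integrable_times_test_function(2)[OF \<Omega> _ \<phi>] loc)
    also have "\<dots> = - ((LINT x|lebesgue_on \<Omega>. f' x $ j * \<phi> x) + (LINT x|lebesgue_on \<Omega>. g' x $ j * \<phi> x))"
      using f g \<phi> unfolding has_weak_gradient_def by simp
    also have "(LINT x|lebesgue_on \<Omega>. f' x $ j * \<phi> x) + (LINT x|lebesgue_on \<Omega>. g' x $ j * \<phi> x)
        = (LINT x|lebesgue_on \<Omega>. (f' x + g' x) $ j * \<phi> x)"
      unfolding vector_add_component distrib_right
      by (intro Bochner_Integration.integral_add[symmetric] integrable_times_test_function(1)[OF \<Omega> _ \<phi>]
          locally_integrable_nth loc)
    finally show ?thesis .
  qed
  then show ?thesis
    using loc unfolding has_weak_gradient_def by (blast intro: locally_integrable_add)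
qed

lemma has_weak_gradient_scaleR:
  assumes f: "has_weak_gradient \<Omega> f f'"
  shows "has_weak_gradient \<Omega> (\<lambda>x. r *\<^sub>R f x) (\<lambda>x. r *\<^sub>R f' x)"
proof -
  have "(LINT x|lebesgue_on \<Omega>. (r *\<^sub>R f x) * partial_deriv \<phi> j x)
      = - (LINT x|lebesgue_on \<Omega>. (r *\<^sub>R f' x) $ j * \<phi> x)" if "\<phi> \<in> test_functions \<Omega>" for \<phi> j
  proof -
    have "(LINT x|lebesgue_on \<Omega>. f x * partial_deriv \<phi> j x) = - (LINT x|lebesgue_on \<Omega>. f' x $ j * \<phi> x)"
      using f that unfolding has_weak_gradient_def by blast
    then show ?thesis
      unfolding vector_scaleR_component real_scaleR_def mult.assoc integral_mult_right_zero by simp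
  qed
  then show ?thesis
    using f unfolding has_weak_gradient_def by (blast intro: locally_integrable_scaleR)
qed

text \<open>Two weak gradients integrate to the same value against every test function, so the
  fundamental lemma applies to each component of their difference.\<close>

lemma has_weak_gradient_unique:
  assumes \<Omega>: "open \<Omega>" and g: "has_weak_gradient \<Omega> f g" and h: "has_weak_gradient \<Omega> f h"
  shows "AE x in lebesgue_on \<Omega>. g x = h x"
proof -
  have loc: "locally_integrable \<Omega> (\<lambda>x. g x $ j)" "locally_integrable \<Omega> (\<lambda>x. - h x $ j)" for j
    using g h locally_integrable_bounded_linear[OF bounded_linear_minus[OF bounded_linear_vec_nth], of \<Omega> h j]
    by (auto simp: has_weak_gradient_def locally_integrable_nth)
  have "AE x in lebesgue_on \<Omega>. g x $ j + - h x $ j = 0" for j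
  proof (rule fundamental_lemma_of_variations[OF \<Omega> locally_integrable_add[OF loc]])
    fix \<phi> assume \<phi>: "\<phi> \<in> test_functions \<Omega>"
    have "(LINT x|lebesgue_on \<Omega>. (g x $ j + - h x $ j) * \<phi> x)
        = (LINT x|lebesgue_on \<Omega>. g x $ j * \<phi> x) + (LINT x|lebesgue_on \<Omega>. - h x $ j * \<phi> x)"
      unfolding distrib_right
      by (intro Bochner_Integration.integral_add integrable_times_test_function(1)[OF \<Omega> _ \<phi>] loc)
    also have "\<dots> = 0"
      using g h \<phi> by (simp add: has_weak_gradient_def)
    finally show "(LINT x|lebesgue_on \<Omega>. (g x $ j + - h x $ j) * \<phi> x) = 0" .
  qed
  then have "AE x in lebesgue_on \<Omega>. \<forall>j\<in>UNIV. g x $ j + - h x $ j = 0"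
    by (subst AE_ball_countable) (auto intro: countable_finite)
  then show ?thesis
    by eventually_elim (auto simp: vec_eq_iff)
qed


section \<open>Symmetric positive semidefinite forms\<close>

definition bilinear_on :: "'v::real_vector set \<Rightarrow> 'w::real_vector set \<Rightarrow> ('v \<Rightarrow> 'w \<Rightarrow> real) \<Rightarrow> bool" where
  "bilinear_on S S' B \<longleftrightarrow>
     (\<forall>x\<in>S. \<forall>y\<in>S. \<forall>z\<in>S'. B (x + y) z = B x z + B y z) \<and>
     (\<forall>r. \<forall>x\<in>S. \<forall>z\<in>S'. B (r *\<^sub>R x) z = r * B x z) \<and>
     (\<forall>x\<in>S. \<forall>y\<in>S'. \<forall>z\<in>S'. B x (y + z) = B x y + B x z) \<and>
     (\<forall>r. \<forall>x\<in>S. \<forall>z\<in>S'. B x (r *\<^sub>R z) = r * B x z)"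

lemma bilinear_onD:
  assumes "bilinear_on S S' B"
  shows "x \<in> S \<Longrightarrow> y \<in> S \<Longrightarrow> z \<in> S' \<Longrightarrow> B (x + y) z = B x z + B y z"
    and "x \<in> S \<Longrightarrow> z \<in> S' \<Longrightarrow> B (r *\<^sub>R x) z = r * B x z"
    and "x \<in> S \<Longrightarrow> y' \<in> S' \<Longrightarrow> z \<in> S' \<Longrightarrow> B x (y' + z) = B x y' + B x z"
    and "x \<in> S \<Longrightarrow> z \<in> S' \<Longrightarrow> B x (r *\<^sub>R z) = r * B x z"
  using assms by (auto simp: bilinear_on_def)

lemma bilinear_on_diff:
  assumes B: "bilinear_on S S' B" and S: "subspace S" "subspace S'"
  shows "x \<in> S \<Longrightarrow> y \<in> S \<Longrightarrow> z \<in> S' \<Longrightarrow> B (x - y) z = B x z - B y z"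
    and "x \<in> S \<Longrightarrow> y' \<in> S' \<Longrightarrow> z \<in> S' \<Longrightarrow> B x (y' - z) = B x y' - B x z"
  using bilinear_onD(1)[OF B, of x "-1 *\<^sub>R y" z] bilinear_onD(2)[OF B, of y z "-1"]
    bilinear_onD(3)[OF B, of x y' "-1 *\<^sub>R z"] bilinear_onD(4)[OF B, of x z "-1"]
    subspace_neg[OF S(1), of y] subspace_neg[OF S(2), of z]
  by simp_all

definition psd_form_on :: "'v::real_vector set \<Rightarrow> ('v \<Rightarrow> 'v \<Rightarrow> real) \<Rightarrow> bool" where
  "psd_form_on S B \<longleftrightarrow> subspace S \<and> bilinear_on S S B \<and>
     (\<forall>x\<in>S. \<forall>y\<in>S. B x y = B y x) \<and> (\<forall>x\<in>S. 0 \<le> B x x)"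

lemma bilinear_on_subset: "bilinear_on S S' B \<Longrightarrow> T \<subseteq> S \<Longrightarrow> T' \<subseteq> S' \<Longrightarrow> bilinear_on T T' B"
  unfolding bilinear_on_def by (meson subsetD)

lemma psd_form_on_subset: "psd_form_on S B \<Longrightarrow> subspace T \<Longrightarrow> T \<subseteq> S \<Longrightarrow> psd_form_on T B"
  unfolding psd_form_on_def bilinear_on_def by (meson subsetD)

lemma psd_form_on_add:
  assumes "psd_form_on S B1" "psd_form_on S B2" "\<And>x y. x \<in> S \<Longrightarrow> y \<in> S \<Longrightarrow> B x y = B1 x y + B2 x y"
  shows "psd_form_on S B"
  using assms subspace_add[of S] subspace_scale[of S]
  by (simp add: psd_form_on_def bilinear_on_def algebra_simps)

lemma form_norm_power2: "psd_form_on S B \<Longrightarrow> x \<in> S \<Longrightarrow> (form_norm B x)\<^sup>2 = B x x"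
  by (simp add: psd_form_on_def form_norm_def)

lemma form_norm_uminus:
  assumes "psd_form_on S B" "x \<in> S"
  shows "form_norm B (- x) = form_norm B x"
  using assms bilinear_onD(2)[of S S B x "- x" "-1"] bilinear_onD(4)[of S S B x x "-1"]
    subspace_neg[of S x]
  by (simp add: psd_form_on_def form_norm_def)

lemma psd_form_young:
  assumes B: "psd_form_on S B" and "x \<in> S" "y \<in> S"
  shows "2 * B x y \<le> B x x + B y y"
proof -
  have S: "subspace S" "bilinear_on S S B" "B x y = B y x"
    using assms by (auto simp: psd_form_on_def)
  have "0 \<le> B (x - y) (x - y)"
    using assms subspace_diff[OF S(1), of x y] by (simp add: psd_form_on_def)
  also have "\<dots> = B x x - 2 * B x y + B y y"
    using assms(2,3) S(3) subspace_diff[OF S(1), of x y]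
    by (simp add: bilinear_on_diff[OF S(2) S(1) S(1)])
  finally show ?thesis by simp
qed

lemma psd_form_polarization:
  assumes B: "psd_form_on S B" and "x \<in> S" "y \<in> S"
  shows "2 * B x (x - y) = B x x - B y y + B (x - y) (x - y)"
proof -
  have S: "subspace S" "bilinear_on S S B" "B x y = B y x"
    using assms by (auto simp: psd_form_on_def)
  show ?thesis
    using assms(2,3) S(3) subspace_diff[OF S(1), of x y]
    by (simp add: bilinear_on_diff[OF S(2) S(1) S(1)])
qed


section \<open>Forms given by weighted integrals\<close>

lemma L2_weighted_product_integrable:
  fixes g h :: "'a::euclidean_space \<Rightarrow> 'b::euclidean_space"
  assumes k: "k \<in> borel_measurable (lebesgue_on \<Omega>)" "AE x in lebesgue_on \<Omega>. \<bar>k x\<bar> \<le> C"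
    and gh: "g \<in> L2_space \<Omega>" "h \<in> L2_space \<Omega>"
  shows "integrable (lebesgue_on \<Omega>) (\<lambda>x. k x * (g x \<bullet> h x))"
proof (rule Bochner_Integration.integrable_bound)
  have m: "g \<in> borel_measurable (lebesgue_on \<Omega>)" "h \<in> borel_measurable (lebesgue_on \<Omega>)"
    using gh by (auto simp: L2_space_def)
  show "integrable (lebesgue_on \<Omega>) (\<lambda>x. C * ((norm (g x))\<^sup>2 + (norm (h x))\<^sup>2))"
    using gh by (auto simp: L2_space_def)
  show "(\<lambda>x. k x * (g x \<bullet> h x)) \<in> borel_measurable (lebesgue_on \<Omega>)"
    using k(1) m by measurable
  show "AE x in lebesgue_on \<Omega>. norm (k x * (g x \<bullet> h x)) \<le> norm (C * ((norm (g x))\<^sup>2 + (norm (h x))\<^sup>2))"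
    using k(2)
  proof eventually_elim
    case (elim x)
    have "\<bar>g x \<bullet> h x\<bar> \<le> norm (g x) * norm (h x)"
      by (rule Cauchy_Schwarz_ineq2)
    also have "\<dots> \<le> (norm (g x))\<^sup>2 + (norm (h x))\<^sup>2"
      using sum_squares_bound[of "norm (g x)" "norm (h x)"]
        mult_nonneg_nonneg[OF norm_ge_zero norm_ge_zero, of "g x" "h x"] by linarith
    finally have "\<bar>k x\<bar> * \<bar>g x \<bullet> h x\<bar> \<le> C * ((norm (g x))\<^sup>2 + (norm (h x))\<^sup>2)"
      using elim by (intro mult_mono) auto
    also have "\<dots> \<le> \<bar>C\<bar> * ((norm (g x))\<^sup>2 + (norm (h x))\<^sup>2)"
      by (intro mult_right_mono) auto
    finally show ?case by (simp add: abs_mult)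
  qed
qed

lemma L2_space_add:
  fixes g h :: "'a::euclidean_space \<Rightarrow> 'b::euclidean_space"
  assumes "g \<in> L2_space \<Omega>" "h \<in> L2_space \<Omega>"
  shows "(\<lambda>x. g x + h x) \<in> L2_space \<Omega>"
proof -
  have "integrable (lebesgue_on \<Omega>) (\<lambda>x. (norm (g x))\<^sup>2 + 2 * (g x \<bullet> h x) + (norm (h x))\<^sup>2)"
    using assms L2_weighted_product_integrable[of "\<lambda>_. 2" \<Omega> 2 g h] by (auto simp: L2_space_def)
  then show ?thesis
    using assms by (auto simp: L2_space_def power2_norm_eq_inner inner_add inner_commute algebra_simps)
qed

lemma L2_space_linear:
  fixes L :: "'b::euclidean_space \<Rightarrow> 'c::euclidean_space"
  assumes L: "linear L" and g: "g \<in> L2_space \<Omega>"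
  shows "(\<lambda>x. L (g x)) \<in> L2_space \<Omega>"
proof -
  have L': "bounded_linear L" using L by (simp add: linear_conv_bounded_linear)
  then obtain C where C: "\<And>y. norm (L y) \<le> norm y * C"
    using bounded_linear.bounded by blast
  have m: "(\<lambda>x. L (g x)) \<in> borel_measurable (lebesgue_on \<Omega>)"
    using g linear_continuous_on[OF L', of UNIV]
    by (intro measurable_compose[of g _ borel L]) (auto simp: L2_space_def borel_measurable_continuous_onI)
  have "integrable (lebesgue_on \<Omega>) (\<lambda>x. (norm (L (g x)))\<^sup>2)"
  proof (rule Bochner_Integration.integrable_bound)
    show "integrable (lebesgue_on \<Omega>) (\<lambda>x. (norm (g x))\<^sup>2 * C\<^sup>2)"
      using g by (simp add: L2_space_def)
    show "AE x in lebesgue_on \<Omega>. norm ((norm (L (g x)))\<^sup>2) \<le> norm ((norm (g x))\<^sup>2 * C\<^sup>2)"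
      using power_mono[OF C norm_ge_zero, of _ 2] by (intro AE_I2) (simp add: power_mult_distrib)
  qed (use m in measurable)
  with m show ?thesis by (simp add: L2_space_def)
qed

text \<open>The operators of interest (weak gradient, divergence, strain) return a chosen
  representative of a class of functions, so they are linear only up to null sets. Integrals of
  their products are nevertheless exactly bilinear, provided that they exist, which is what
  membership in \<open>L2_space\<close> guarantees.\<close>

definition ae_linear ::
    "'a::euclidean_space set \<Rightarrow> 'f::real_vector set \<Rightarrow> ('f \<Rightarrow> 'a \<Rightarrow> 'b::euclidean_space) \<Rightarrow> bool" where
  "ae_linear \<Omega> S G \<longleftrightarrow> (\<forall>f\<in>S. G f \<in> L2_space \<Omega>) \<and>
     (\<forall>f\<in>S. \<forall>g\<in>S. AE x in lebesgue_on \<Omega>. G (f + g) x = G f x + G g x) \<and>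
     (\<forall>r. \<forall>f\<in>S. AE x in lebesgue_on \<Omega>. G (r *\<^sub>R f) x = r *\<^sub>R G f x)"

lemma ae_linearD:
  assumes "ae_linear \<Omega> S G" "f \<in> S"
  shows "G f \<in> L2_space \<Omega>"
    and "g \<in> S \<Longrightarrow> AE x in lebesgue_on \<Omega>. G (f + g) x = G f x + G g x"
    and "AE x in lebesgue_on \<Omega>. G (r *\<^sub>R f) x = r *\<^sub>R G f x"
  using assms by (auto simp: ae_linear_def)

lemma ae_linear_linear:
  assumes L: "linear L" and G: "ae_linear \<Omega> S G"
  shows "ae_linear \<Omega> S (\<lambda>f x. L (G f x))"
  unfolding ae_linear_def
proof (intro conjI ballI allI)
  fix f g r assume fg: "f \<in> S" "g \<in> S"
  show "AE x in lebesgue_on \<Omega>. L (G (f + g) x) = L (G f x) + L (G g x)"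
    using ae_linearD(2)[OF G fg] by eventually_elim (simp add: linear_add[OF L])
next
  fix f r assume f: "f \<in> S"
  show "(\<lambda>x. L (G f x)) \<in> L2_space \<Omega>"
    by (rule L2_space_linear[OF L ae_linearD(1)[OF G f]])
  show "AE x in lebesgue_on \<Omega>. L (G (r *\<^sub>R f) x) = r *\<^sub>R L (G f x)"
    using ae_linearD(3)[OF G f, of r] by eventually_elim (simp add: linear_scale[OF L])
qed

lemma ae_linear_add:
  assumes G: "ae_linear \<Omega> S G" and H: "ae_linear \<Omega> S H"
  shows "ae_linear \<Omega> S (\<lambda>f x. G f x + H f x)"
  unfolding ae_linear_def
proof (intro conjI ballI allI)
  fix f g assume fg: "f \<in> S" "g \<in> S"
  show "AE x in lebesgue_on \<Omega>. G (f + g) x + H (f + g) x = G f x + H f x + (G g x + H g x)"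
    using ae_linearD(2)[OF G fg] ae_linearD(2)[OF H fg] by eventually_elim simp
next
  fix f r assume f: "f \<in> S"
  show "(\<lambda>x. G f x + H f x) \<in> L2_space \<Omega>"
    by (intro L2_space_add ae_linearD(1)[OF _ f] G H)
  show "AE x in lebesgue_on \<Omega>. G (r *\<^sub>R f) x + H (r *\<^sub>R f) x = r *\<^sub>R (G f x + H f x)"
    using ae_linearD(3)[OF G f, of r] ae_linearD(3)[OF H f, of r]
    by eventually_elim (simp add: scaleR_right_distrib)
qed

lemma ae_linear_sum:
  assumes "finite I" "\<And>i. i \<in> I \<Longrightarrow> ae_linear \<Omega> S (G i)"
  shows "ae_linear \<Omega> S (\<lambda>f x. \<Sum>i\<in>I. G i f x)"
  using assms
proof (induction I rule: finite_induct)
  case empty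
  show ?case by (simp add: ae_linear_def L2_space_def)
next
  case (insert i I)
  then show ?case by (simp add: ae_linear_add)
qed

text \<open>A bounded weight times a product of square integrable functions is integrable, so the
  integral distributes over sums, and it does not see the null sets on which the operators fail to
  be linear.\<close>

lemma bilinear_on_weighted_product:
  assumes k: "k \<in> borel_measurable (lebesgue_on \<Omega>)" "AE x in lebesgue_on \<Omega>. \<bar>k x\<bar> \<le> C"
    and G: "ae_linear \<Omega> S G" and H: "ae_linear \<Omega> S' H" and S: "subspace S" "subspace S'"
  shows "bilinear_on S S' (\<lambda>f g. LINT x|lebesgue_on \<Omega>. k x * (G f x \<bullet> H g x))"
proof -
  have int: "integrable (lebesgue_on \<Omega>) (\<lambda>x. k x * (G f x \<bullet> H g x))" if "f \<in> S" "g \<in> S'" for f g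
    using that ae_linearD(1)[OF G] ae_linearD(1)[OF H] by (intro L2_weighted_product_integrable[OF k])
  have cong: "(LINT x|lebesgue_on \<Omega>. k x * (G f x \<bullet> H g x)) = (LINT x|lebesgue_on \<Omega>. j x)"
    if "f \<in> S" "g \<in> S'" "integrable (lebesgue_on \<Omega>) j" "AE x in lebesgue_on \<Omega>. k x * (G f x \<bullet> H g x) = j x" for f g j
    using that int by (intro integral_cong_AE) auto
  show ?thesis
    unfolding bilinear_on_def
  proof (intro conjI ballI allI)
    fix f1 f2 g assume f: "f1 \<in> S" "f2 \<in> S" "g \<in> S'"
    show "(LINT x|lebesgue_on \<Omega>. k x * (G (f1 + f2) x \<bullet> H g x))
      = (LINT x|lebesgue_on \<Omega>. k x * (G f1 x \<bullet> H g x)) + (LINT x|lebesgue_on \<Omega>. k x * (G f2 x \<bullet> H g x))"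
    proof (subst Bochner_Integration.integral_add[symmetric, OF int int]; (intro cong)?)
      show "AE x in lebesgue_on \<Omega>. k x * (G (f1 + f2) x \<bullet> H g x)
          = k x * (G f1 x \<bullet> H g x) + k x * (G f2 x \<bullet> H g x)"
        using ae_linearD(2)[OF G f(1,2)] by eventually_elim (simp add: inner_add_left distrib_left)
    qed (use f S int in \<open>auto intro: subspace_add\<close>)
  next
    fix f g1 g2 assume f: "f \<in> S" "g1 \<in> S'" "g2 \<in> S'"
    show "(LINT x|lebesgue_on \<Omega>. k x * (G f x \<bullet> H (g1 + g2) x))
      = (LINT x|lebesgue_on \<Omega>. k x * (G f x \<bullet> H g1 x)) + (LINT x|lebesgue_on \<Omega>. k x * (G f x \<bullet> H g2 x))"
    proof (subst Bochner_Integration.integral_add[symmetric, OF int int]; (intro cong)?)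
      show "AE x in lebesgue_on \<Omega>. k x * (G f x \<bullet> H (g1 + g2) x)
          = k x * (G f x \<bullet> H g1 x) + k x * (G f x \<bullet> H g2 x)"
        using ae_linearD(2)[OF H f(2,3)] by eventually_elim (simp add: inner_add_right distrib_left)
    qed (use f S int in \<open>auto intro: subspace_add\<close>)
  next
    fix r f g assume f: "f \<in> S" "g \<in> S'"
    show "(LINT x|lebesgue_on \<Omega>. k x * (G (r *\<^sub>R f) x \<bullet> H g x)) = r * (LINT x|lebesgue_on \<Omega>. k x * (G f x \<bullet> H g x))"
    proof (subst integral_mult_right_zero[symmetric], intro cong)
      show "AE x in lebesgue_on \<Omega>. k x * (G (r *\<^sub>R f) x \<bullet> H g x) = r * (k x * (G f x \<bullet> H g x))"
        using ae_linearD(3)[OF G f(1), of r] by eventually_elim simp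
    qed (use f S int in \<open>auto intro: subspace_scale\<close>)
    show "(LINT x|lebesgue_on \<Omega>. k x * (G f x \<bullet> H (r *\<^sub>R g) x)) = r * (LINT x|lebesgue_on \<Omega>. k x * (G f x \<bullet> H g x))"
    proof (subst integral_mult_right_zero[symmetric], intro cong)
      show "AE x in lebesgue_on \<Omega>. k x * (G f x \<bullet> H (r *\<^sub>R g) x) = r * (k x * (G f x \<bullet> H g x))"
        using ae_linearD(3)[OF H f(2), of r] by eventually_elim simp
    qed (use f S int in \<open>auto intro: subspace_scale\<close>)
  qed
qed

lemma positive_coefficient_bounded:
  assumes "positive_coefficient \<Omega> k"
  obtains C where "k \<in> borel_measurable (lebesgue_on \<Omega>)" "AE x in lebesgue_on \<Omega>. \<bar>k x\<bar> \<le> C"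
    "AE x in lebesgue_on \<Omega>. 0 \<le> k x"
proof -
  obtain lo hi where k: "k \<in> borel_measurable (lebesgue_on \<Omega>)" "0 < lo"
    "AE x in lebesgue_on \<Omega>. lo \<le> k x \<and> k x \<le> hi"
    using assms by (auto simp: positive_coefficient_def)
  have "AE x in lebesgue_on \<Omega>. \<bar>k x\<bar> \<le> hi" "AE x in lebesgue_on \<Omega>. 0 \<le> k x"
    using k(3) by (eventually_elim, use k(2) in auto)+
  with k(1) show thesis by (rule that)
qed

lemma positive_coefficient_integrable:
  assumes "positive_coefficient \<Omega> k" "ae_linear \<Omega> S G" "f \<in> S" "g \<in> S"
  shows "integrable (lebesgue_on \<Omega>) (\<lambda>x. k x * (G f x \<bullet> G g x))"
  using assms(1)
  by (rule positive_coefficient_bounded)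
     (auto intro!: L2_weighted_product_integrable ae_linearD(1)[OF assms(2)] assms simp del: inner_real_def)

lemma psd_form_on_weighted_product:
  assumes k: "positive_coefficient \<Omega> k" and G: "ae_linear \<Omega> S G" and S: "subspace S"
  shows "psd_form_on S (\<lambda>f g. LINT x|lebesgue_on \<Omega>. k x * (G f x \<bullet> G g x))"
proof -
  obtain C where k': "k \<in> borel_measurable (lebesgue_on \<Omega>)" "AE x in lebesgue_on \<Omega>. \<bar>k x\<bar> \<le> C"
    "AE x in lebesgue_on \<Omega>. 0 \<le> k x"
    using k by (rule positive_coefficient_bounded)
  have "0 \<le> (LINT x|lebesgue_on \<Omega>. k x * (G f x \<bullet> G f x))" for f
    using k'(3) by (intro integral_nonneg_AE, eventually_elim) auto
  then show ?thesis
    using bilinear_on_weighted_product[OF k'(1,2) G G S S] S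
    by (auto simp: psd_form_on_def inner_commute)
qed


section \<open>The poroelastic forms\<close>

lemma H1_subspace:
  assumes \<Omega>: "open \<Omega>"
  shows "subspace (H1 \<Omega> :: (real^'d \<Rightarrow> real) set)"
proof (rule subspaceI)
  have "has_weak_gradient \<Omega> (\<lambda>_. 0) (\<lambda>_. 0 :: real^'d)"
    by (simp add: has_weak_gradient_def locally_integrable_def set_integrable_def)
  moreover have "(\<lambda>_. 0 :: real) \<in> L2_space \<Omega>" "(\<lambda>_. 0 :: real^'d) \<in> L2_space \<Omega>"
    by (simp_all add: L2_space_def)
  ultimately show "(0 :: real^'d \<Rightarrow> real) \<in> H1 \<Omega>"
    unfolding zero_fun_def H1_def by blast
next
  fix f g :: "real^'d \<Rightarrow> real" assume "f \<in> H1 \<Omega>" "g \<in> H1 \<Omega>"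
  then show "f + g \<in> H1 \<Omega>"
    unfolding plus_fun_def H1_def
    by (auto intro: L2_space_add has_weak_gradient_add[OF \<Omega>])
next
  fix f :: "real^'d \<Rightarrow> real" and r assume "f \<in> H1 \<Omega>"
  then obtain g where "f \<in> L2_space \<Omega>" "g \<in> L2_space \<Omega>" "has_weak_gradient \<Omega> f g"
    unfolding H1_def by blast
  then show "r *\<^sub>R f \<in> H1 \<Omega>"
    unfolding scaleR_fun_def H1_def
    using L2_space_linear[OF linear_scale_self, of f \<Omega> r] L2_space_linear[OF linear_scale_self, of g \<Omega> r]
      has_weak_gradient_scaleR[of \<Omega> f g r] by blast
qed

lemma weak_gradient_ae_eq:
  assumes "open \<Omega>" "has_weak_gradient \<Omega> f g"
  shows "AE x in lebesgue_on \<Omega>. weak_gradient \<Omega> f x = g x"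
proof -
  have "has_weak_gradient \<Omega> f (weak_gradient \<Omega> f)"
    unfolding weak_gradient_def using assms(2) by (rule someI[of "has_weak_gradient \<Omega> f"])
  then show ?thesis
    using assms by (intro has_weak_gradient_unique)
qed

text \<open>Sums and multiples of weak gradients are weak gradients of the sums and multiples, and
  uniqueness identifies them with the chosen representatives almost everywhere. The same
  uniqueness makes the chosen gradient square integrable.\<close>

lemma ae_linear_weak_gradient:
  fixes \<Omega> :: "(real^'d) set"
  assumes \<Omega>: "open \<Omega>"
  shows "ae_linear \<Omega> (H1 \<Omega>) (weak_gradient \<Omega>)"
proof -
  have weak: "has_weak_gradient \<Omega> f (weak_gradient \<Omega> f)" if "f \<in> H1 \<Omega>" for f
    using that someI[of "has_weak_gradient \<Omega> f"] by (auto simp: H1_def weak_gradient_def)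
  have L2: "weak_gradient \<Omega> f \<in> L2_space \<Omega>" if f: "f \<in> H1 \<Omega>" for f
  proof -
    obtain g where g: "g \<in> L2_space \<Omega>" "has_weak_gradient \<Omega> f g"
      using f by (auto simp: H1_def)
    have m: "weak_gradient \<Omega> f \<in> borel_measurable (lebesgue_on \<Omega>)" "g \<in> borel_measurable (lebesgue_on \<Omega>)"
      using weak[OF f] g by (auto simp: has_weak_gradient_def intro!: locally_integrable_borel_measurable[OF \<Omega>])
    have "AE x in lebesgue_on \<Omega>. (norm (g x))\<^sup>2 = (norm (weak_gradient \<Omega> f x))\<^sup>2"
      using weak_gradient_ae_eq[OF \<Omega> g(2)] by eventually_elim simp
    then have "integrable (lebesgue_on \<Omega>) (\<lambda>x. (norm (weak_gradient \<Omega> f x))\<^sup>2)"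
      using g(1) m by (subst integrable_cong_AE[symmetric]) (auto simp: L2_space_def)
    with m show ?thesis by (simp add: L2_space_def)
  qed
  show ?thesis
    unfolding ae_linear_def plus_fun_def scaleR_fun_def
  proof (intro conjI ballI allI)
    fix f g :: "real^'d \<Rightarrow> real" assume "f \<in> H1 \<Omega>" "g \<in> H1 \<Omega>"
    then show "AE x in lebesgue_on \<Omega>. weak_gradient \<Omega> (\<lambda>x. f x + g x) x = weak_gradient \<Omega> f x + weak_gradient \<Omega> g x"
      by (intro weak_gradient_ae_eq[OF \<Omega>] has_weak_gradient_add[OF \<Omega>] weak)
  next
    fix f :: "real^'d \<Rightarrow> real" and r assume f: "f \<in> H1 \<Omega>"
    then show "weak_gradient \<Omega> f \<in> L2_space \<Omega>"
      by (rule L2)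
    show "AE x in lebesgue_on \<Omega>. weak_gradient \<Omega> (\<lambda>x. r *\<^sub>R f x) x = r *\<^sub>R weak_gradient \<Omega> f x"
      by (intro weak_gradient_ae_eq[OF \<Omega>] has_weak_gradient_scaleR weak f)
  qed
qed

definition H1_vec :: "(real^'d) set \<Rightarrow> (real^'d \<Rightarrow> real^'d) set" where
  "H1_vec \<Omega> = {u. \<forall>i. (\<lambda>x. u x $ i) \<in> H1 \<Omega>}"

lemma component_linear:
  "(\<lambda>x. (u + v) x $ i) = (\<lambda>x. u x $ i) + (\<lambda>x. v x $ i)"
  "(\<lambda>x. (r *\<^sub>R u) x $ i) = r *\<^sub>R (\<lambda>x. u x $ i)"
  by (auto simp: scaleR_fun_def)

lemma H1_vec_subspace:
  assumes "open \<Omega>"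
  shows "subspace (H1_vec \<Omega>)"
proof -
  note H1 = H1_subspace[OF assms]
  show ?thesis
    using subspace_0[OF H1] subspace_add[OF H1] subspace_scale[OF H1]
    unfolding subspace_def H1_vec_def mem_Collect_eq component_linear
    by (auto simp: zero_fun_def)
qed

text \<open>The Jacobian is the sum over its rows of the linear embeddings \<open>axis i\<close>
  applied to the gradients of the components.\<close>

lemma ae_linear_weak_jacobian:
  fixes \<Omega> :: "(real^'d) set"
  assumes \<Omega>: "open \<Omega>"
  shows "ae_linear \<Omega> (H1_vec \<Omega>) (weak_jacobian \<Omega>)"
proof -
  have row: "ae_linear \<Omega> (H1_vec \<Omega>) (\<lambda>u. weak_gradient \<Omega> (\<lambda>x. u x $ i))" for i
    using ae_linear_weak_gradient[OF \<Omega>]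
    unfolding ae_linear_def component_linear by (auto simp: H1_vec_def)
  have lin: "linear (axis i :: real^'d \<Rightarrow> real^'d^'d)" for i
    by (auto intro!: linearI simp: axis_def vec_eq_iff)
  have "weak_jacobian \<Omega> = (\<lambda>u x. \<Sum>i\<in>UNIV. axis i (weak_gradient \<Omega> (\<lambda>x. u x $ i) x))"
    by (auto simp: weak_jacobian_def vec_eq_iff axis_def fun_eq_iff if_distrib[of "\<lambda>v. v $ _"] cong: if_cong)
  then show ?thesis
    using ae_linear_sum[OF finite_class.finite_UNIV ae_linear_linear[OF lin row]] by simp
qed

lemma ae_linear_weak_div:
  assumes "open \<Omega>"
  shows "ae_linear \<Omega> (H1_vec \<Omega>) (weak_div \<Omega>)"
proof -
  have "linear (trace :: real^'d^'d \<Rightarrow> real)"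
    by (auto intro!: linearI simp: trace_def sum.distrib sum_distrib_left)
  then show ?thesis
    using ae_linear_linear[OF _ ae_linear_weak_jacobian[OF assms]]
    by (simp add: weak_div_def[abs_def])
qed

lemma ae_linear_strain:
  assumes "open \<Omega>"
  shows "ae_linear \<Omega> (H1_vec \<Omega>) (strain \<Omega>)"
proof -
  have "linear (\<lambda>A :: real^'d^'d. (1/2) *\<^sub>R (A + transpose A))"
    by (auto intro!: linearI simp: transpose_def vec_eq_iff algebra_simps)
  then show ?thesis
    using ae_linear_linear[OF _ ae_linear_weak_jacobian[OF assms]]
    by (simp add: strain_def[abs_def])
qed

lemma ae_linear_id:
  "S \<subseteq> L2_space \<Omega> \<Longrightarrow> ae_linear \<Omega> S (\<lambda>f. f)"
  by (auto simp: ae_linear_def scaleR_fun_def)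

lemma inner_mat_1: "mat 1 \<bullet> (A :: real^'d^'d) = trace A"
  by (simp add: inner_vec_def mat_def trace_def if_distrib[of "\<lambda>r. r * _"] cong: if_cong)

lemma trace_strain: "trace (strain \<Omega> u x) = weak_div \<Omega> u x"
  by (simp add: strain_def weak_div_def trace_def transpose_def sum.distrib[symmetric] sum_divide_distrib[symmetric])

lemma positive_coefficient_scale:
  assumes "positive_coefficient \<Omega> k" "0 < r"
  shows "positive_coefficient \<Omega> (\<lambda>x. r * k x)"
proof -
  obtain lo hi where k: "k \<in> borel_measurable (lebesgue_on \<Omega>)" "0 < lo"
    "AE x in lebesgue_on \<Omega>. lo \<le> k x \<and> k x \<le> hi"
    using assms by (auto simp: positive_coefficient_def)
  have "AE x in lebesgue_on \<Omega>. r * lo \<le> r * k x \<and> r * k x \<le> r * hi"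
    using k(3) by eventually_elim (use assms(2) in auto)
  then show ?thesis
    using k assms(2) unfolding positive_coefficient_def
    by (intro conjI exI[of _ "r * lo"] exI[of _ "r * hi"]) auto
qed

text \<open>Contracting the identity tensor with the strain gives its trace, the divergence, so
  the elastic form is the sum of a strain form with weight \<open>2 * \<mu>\<close> and a
  divergence form with weight \<open>lam\<close>.\<close>

lemma psd_form_a:
  assumes \<Omega>: "open \<Omega>" and k: "positive_coefficient \<Omega> lam" "positive_coefficient \<Omega> \<mu>"
  shows "psd_form_on (H1_vec \<Omega>) (form_a \<Omega> lam \<mu>)"
proof (rule psd_form_on_add)
  let ?A = "\<lambda>u v x. (2 * \<mu> x) * (strain \<Omega> u x \<bullet> strain \<Omega> v x)"
    and ?D = "\<lambda>u v x. lam x * (weak_div \<Omega> u x \<bullet> weak_div \<Omega> v x)"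
  note S = H1_vec_subspace[OF \<Omega>]
  note k' = positive_coefficient_scale[OF k(2), of 2, simplified]
  show "psd_form_on (H1_vec \<Omega>) (\<lambda>u v. LINT x|lebesgue_on \<Omega>. ?A u v x)"
    by (rule psd_form_on_weighted_product[OF k' ae_linear_strain[OF \<Omega>] S])
  show "psd_form_on (H1_vec \<Omega>) (\<lambda>u v. LINT x|lebesgue_on \<Omega>. ?D u v x)"
    by (rule psd_form_on_weighted_product[OF k(1) ae_linear_weak_div[OF \<Omega>] S])
  fix u v assume uv: "u \<in> H1_vec \<Omega>" "v \<in> H1_vec \<Omega>"
  have "stress \<Omega> lam \<mu> u x \<bullet> strain \<Omega> v x = ?A u v x + ?D u v x" for x
    by (simp add: stress_def inner_add_left inner_mat_1 trace_strain)
  then show "form_a \<Omega> lam \<mu> u v = (LINT x|lebesgue_on \<Omega>. ?A u v x) + (LINT x|lebesgue_on \<Omega>. ?D u v x)"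
    unfolding form_a_def
    using positive_coefficient_integrable[OF k' ae_linear_strain[OF \<Omega>] uv]
      positive_coefficient_integrable[OF k(1) ae_linear_weak_div[OF \<Omega>] uv]
    by (simp only: Bochner_Integration.integral_add)
qed

lemma psd_form_b:
  assumes \<Omega>: "open \<Omega>" and k: "positive_coefficient \<Omega> \<kappa>" "\<nu> > 0"
  shows "psd_form_on (H1 \<Omega>) (form_b \<Omega> \<kappa> \<nu>)"
  using psd_form_on_weighted_product[OF positive_coefficient_scale[OF k(1), of "1 / \<nu>"]
      ae_linear_weak_gradient[OF \<Omega>] H1_subspace[OF \<Omega>]] k(2)
  by (simp add: form_b_def[abs_def])

lemma psd_form_c:
  assumes \<Omega>: "open \<Omega>" and M: "M > 0"
  shows "psd_form_on (H1 \<Omega>) (form_c \<Omega> M)"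
proof -
  have "positive_coefficient \<Omega> (\<lambda>_. 1 / M)"
    using M by (auto simp: positive_coefficient_def intro!: exI[of _ "1 / M"])
  then show ?thesis
    using psd_form_on_weighted_product[OF _ ae_linear_id H1_subspace[OF \<Omega>], of \<Omega> "\<lambda>_. 1 / M"]
    by (simp add: form_c_def[abs_def] H1_def mult.assoc)
qed

lemma bilinear_form_d:
  assumes \<Omega>: "open \<Omega>" and \<alpha>: "biot_willis_coefficient \<Omega> \<alpha>"
  shows "bilinear_on (H1_vec \<Omega>) (H1 \<Omega>) (form_d \<Omega> \<alpha>)"
proof -
  have "AE x in lebesgue_on \<Omega>. 0 \<le> \<alpha> x \<and> \<alpha> x \<le> 1"
    using \<alpha> by (simp add: biot_willis_coefficient_def)
  then have "AE x in lebesgue_on \<Omega>. \<bar>\<alpha> x\<bar> \<le> 1"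
    by eventually_elim auto
  moreover have "ae_linear \<Omega> (H1 \<Omega>) (\<lambda>f. f)"
    by (rule ae_linear_id) (auto simp: H1_def)
  ultimately show ?thesis
    using bilinear_on_weighted_product[of \<alpha> \<Omega> 1 _ "weak_div \<Omega>" _ "\<lambda>f. f", OF _ _ ae_linear_weak_div[OF \<Omega>]]
      H1_vec_subspace[OF \<Omega>] H1_subspace[OF \<Omega>] \<alpha>
    by (simp add: form_d_def[abs_def] mult.assoc biot_willis_coefficient_def)
qed

lemma L2_norm_power2: "(L2_norm \<Omega> g)\<^sup>2 = L2_inner \<Omega> g g"
  by (simp add: L2_norm_def L2_inner_def integral_nonneg_AE)

text \<open>Pointwise, the difference of the two integrands is the square of \<open>\<delta> q -
  \<tau> M f\<close> divided by \<open>\<delta> M\<close>.\<close>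

lemma source_term_young:
  assumes f: "f \<in> L2_space \<Omega>" and q: "q \<in> L2_space \<Omega>" and M: "M > 0" and \<delta>: "\<delta> > 0"
  shows "2 * \<tau> * L2_inner \<Omega> f q \<le> \<delta> * form_c \<Omega> M q q + \<tau>\<^sup>2 / \<delta> * (L2_norm \<Omega> (\<lambda>x. sqrt M * f x))\<^sup>2"
proof -
  have "2 * \<tau> * L2_inner \<Omega> f q = (LINT x|lebesgue_on \<Omega>. 2 * \<tau> * (f x \<bullet> q x))"
    by (simp add: L2_inner_def)
  also have "\<dots> \<le> (LINT x|lebesgue_on \<Omega>. \<delta> / M * (q x \<bullet> q x) + \<tau>\<^sup>2 / \<delta> * M * (f x \<bullet> f x))"
  proof (rule integral_mono)
    show "integrable (lebesgue_on \<Omega>) (\<lambda>x. 2 * \<tau> * (f x \<bullet> q x))"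
      using f q by (intro L2_weighted_product_integrable[where C = "\<bar>2 * \<tau>\<bar>"]) auto
    show "integrable (lebesgue_on \<Omega>) (\<lambda>x. \<delta> / M * (q x \<bullet> q x) + \<tau>\<^sup>2 / \<delta> * M * (f x \<bullet> f x))"
      using f q by (intro Bochner_Integration.integrable_add
          L2_weighted_product_integrable[where C = "\<bar>\<delta> / M\<bar>"]
          L2_weighted_product_integrable[where C = "\<bar>\<tau>\<^sup>2 / \<delta> * M\<bar>"]) auto
    show "2 * \<tau> * (f x \<bullet> q x) \<le> \<delta> / M * (q x \<bullet> q x) + \<tau>\<^sup>2 / \<delta> * M * (f x \<bullet> f x)" for x
    proof -
      have "0 \<le> (\<delta> * q x - \<tau> * M * f x)\<^sup>2 / (\<delta> * M)"
        using M \<delta> by simp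
      also have "\<dots> = \<delta> / M * (q x \<bullet> q x) + \<tau>\<^sup>2 / \<delta> * M * (f x \<bullet> f x) - 2 * \<tau> * (f x \<bullet> q x)"
        using M \<delta> by (simp add: field_simps power2_eq_square)
      finally show ?thesis by simp
    qed
  qed
  also have "\<dots> = \<delta> * form_c \<Omega> M q q + \<tau>\<^sup>2 / \<delta> * (L2_norm \<Omega> (\<lambda>x. sqrt M * f x))\<^sup>2"
  proof -
    have "integrable (lebesgue_on \<Omega>) (\<lambda>x. \<delta> / M * (q x \<bullet> q x))" "integrable (lebesgue_on \<Omega>) (\<lambda>x. \<tau>\<^sup>2 / \<delta> * M * (f x \<bullet> f x))"
      using f q by (intro L2_weighted_product_integrable[where C = "\<bar>\<delta> / M\<bar>"]
          L2_weighted_product_integrable[where C = "\<bar>\<tau>\<^sup>2 / \<delta> * M\<bar>"]; simp)+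
    moreover have "(L2_norm \<Omega> (\<lambda>x. sqrt M * f x))\<^sup>2 = M * (LINT x|lebesgue_on \<Omega>. f x \<bullet> f x)"
    proof -
      have "(sqrt M * f x) \<bullet> (sqrt M * f x) = M * (f x \<bullet> f x)" for x
        using M by (simp add: power2_eq_square[symmetric] power_mult_distrib)
      then show ?thesis
        unfolding L2_norm_power2 L2_inner_def by (simp only: integral_mult_right_zero)
    qed
    moreover have "form_c \<Omega> M q q = 1 / M * (LINT x|lebesgue_on \<Omega>. q x \<bullet> q x)"
      by (simp add: form_c_def mult.assoc)
    ultimately show ?thesis
      by (simp only: Bochner_Integration.integral_add integral_mult_right_zero) simp
  qed
  finally show ?thesis .
qed


section \<open>The energy estimate\<close>

text \<open>The strengthened inequality bounds \<open>B x y\<close> from above; a lower bound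
  follows by applying it to \<open>- x\<close>, which is why \<open>- x\<close> has to belong to
  the class \<open>R\<close>.\<close>

lemma strengthened_cauchy_schwarz_young:
  assumes B: "psd_form_on S B" "x \<in> S" "- x \<in> R" "y \<in> S"
    and cs: "\<And>x. x \<in> R \<Longrightarrow> B x y \<le> \<gamma> * form_norm B x * form_norm B y"
    and \<gamma>: "0 < \<gamma>"
  shows "- (2 * B x y) \<le> \<gamma> * (B x x + B y y)"
proof -
  have "- B x y = B (- x) y"
    using bilinear_onD(2)[of S S B x y "-1"] B by (simp add: psd_form_on_def)
  also have "\<dots> \<le> \<gamma> * (form_norm B x * form_norm B y)"
    using cs[OF B(3)] by (simp add: form_norm_uminus[OF B(1,2)])
  finally have "- (2 * B x y) \<le> \<gamma> * (2 * form_norm B x * form_norm B y)"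
    by simp
  also have "\<dots> \<le> \<gamma> * ((form_norm B x)\<^sup>2 + (form_norm B y)\<^sup>2)"
    using \<gamma> by (intro mult_left_mono sum_squares_bound) auto
  finally show ?thesis
    by (simp add: form_norm_power2[OF B(1)] B)
qed

text \<open>Here \<open>w\<close> and \<open>e\<close> are the energies of the displacement and
  pressure increments, with a prime for the lagged ones. Twice the energy balance leaves \<open>2
  - \<gamma>\<^sub>a\<close> in front of each \<open>w\<close>, at least the
  \<open>\<gamma>\<^sub>a\<close> that is wanted. In front of \<open>e1\<close> it leaves \<open>2
  - \<gamma>\<^sub>c\<close>, and in front of \<open>e2\<close>, after the time step restriction
  has absorbed \<open>b2\<close>, exactly \<open>1\<close>. Keeping
  \<open>\<gamma>\<^sub>c\<close> of each, \<open>2 * (1 - \<gamma>\<^sub>c)\<close> and \<open>1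
  - \<gamma>\<^sub>c\<close> remain to absorb the source, at the cost of \<open>1/2\<close> and
  \<open>1\<close> times \<open>\<tau>\<^sup>2 / (1 - \<gamma>\<^sub>c) * F\<close>; their total
  \<open>3/2\<close> is below \<open>2\<close>.\<close>

lemma energy_balance_arithmetic:
  fixes w1 w2 w1' w2' e1 e2 e1' e2' :: real
  assumes bal: "w1 + w2 + a12 + a21 + e1 + e2 + c12 + c21 + \<tau> * bb = \<tau> * (f1 + f2)"
    and a: "- (2 * a12) \<le> \<gamma>\<^sub>a * (w1 + w2')" "- (2 * a21) \<le> \<gamma>\<^sub>a * (w2 + w1')"
    and c: "- (2 * c12) \<le> \<gamma>\<^sub>c * (e1 + e2')" "- (2 * c21) \<le> \<gamma>\<^sub>c * (e2 + e1')"
    and b: "2 * bb \<ge> B1 - B0 - b2" "\<tau> * b2 \<le> (1 - \<gamma>\<^sub>c) * e2"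
    and f: "2 * \<tau> * f1 \<le> 2 * (1 - \<gamma>\<^sub>c) * e1 + \<tau>\<^sup>2 / (2 * (1 - \<gamma>\<^sub>c)) * F"
           "2 * \<tau> * f2 \<le> (1 - \<gamma>\<^sub>c) * e2 + \<tau>\<^sup>2 / (1 - \<gamma>\<^sub>c) * F"
    and pos: "0 \<le> w1" "0 \<le> w2" "0 < \<tau>" "\<gamma>\<^sub>a < 1" "\<gamma>\<^sub>c < 1" "0 \<le> F"
  shows "\<gamma>\<^sub>c * (e1 + e2) + \<gamma>\<^sub>a * (w1 + w2) + \<tau> * B1
    \<le> \<gamma>\<^sub>c * (e1' + e2') + \<gamma>\<^sub>a * (w1' + w2') + \<tau> * B0 + 2 * \<tau>\<^sup>2 / (1 - \<gamma>\<^sub>c) * F"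
proof -
  have 1: "2 * (\<tau> * bb) \<ge> \<tau> * B1 - \<tau> * B0 - \<tau> * b2"
    using mult_left_mono[OF b(1), of \<tau>] pos(3) by (simp add: algebra_simps)
  have 2: "\<gamma>\<^sub>a * w1 \<le> w1" "\<gamma>\<^sub>a * w2 \<le> w2"
    using pos mult_right_mono[of \<gamma>\<^sub>a 1 w1] mult_right_mono[of \<gamma>\<^sub>a 1 w2] by simp_all
  define X where "X = \<tau>\<^sup>2 / (1 - \<gamma>\<^sub>c) * F"
  have X: "0 \<le> X" "\<tau>\<^sup>2 / (2 * (1 - \<gamma>\<^sub>c)) * F = X / 2" "2 * \<tau>\<^sup>2 / (1 - \<gamma>\<^sub>c) * F = 2 * X"
    using pos by (simp_all add: X_def)
  show ?thesis
    using bal a c 1 b(2) f 2 X(1) unfolding X(2,3) X_def[symmetric]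
    by (simp add: distrib_left left_diff_distrib right_diff_distrib)
qed

text \<open>The two pressure equations are tested with the increments \<open>e i n\<close> of
  their own components. The equilibrium equations hold at every time level, so the coupling
  \<open>d v (e i n)\<close> equals \<open>a (w i n) v\<close> for the displacement increment
  \<open>w i n\<close>, and the coupling terms become elastic energies. In both equations the
  diffusion term acts on \<open>p 1 (n + 1) + p 2 n\<close>, that is on \<open>P1 - e 2 n\<close>;
  polarization yields \<open>b P1 P1 - b P0 P0\<close> and leaves \<open>b (e 2 n) (e 2 n)\<close>
  for the time step restriction.\<close>

theorem partially_explicit_energy_estimate:
  fixes a :: "'v::real_vector \<Rightarrow> 'v \<Rightarrow> real" and b c :: "'q::real_vector \<Rightarrow> 'q \<Rightarrow> real"
  assumes a: "psd_form_on V a" and b: "psd_form_on Y b" and c: "psd_form_on Y c"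
    and d: "bilinear_on V Y d"
    and Q: "subspace (Q 1)" "Q 1 \<subseteq> Y" "subspace (Q 2)" "Q 2 \<subseteq> Y"
    and cs_c: "\<forall>p\<^sub>1\<in>Q 1. \<forall>p\<^sub>2\<in>Q 2. c p\<^sub>1 p\<^sub>2 \<le> \<gamma>\<^sub>c * form_norm c p\<^sub>1 * form_norm c p\<^sub>2"
    and cs_a: "\<forall>u\<^sub>1\<in>elastic_responses a d V (Q 1). \<forall>u\<^sub>2\<in>elastic_responses a d V (Q 2).
           a u\<^sub>1 u\<^sub>2 \<le> \<gamma>\<^sub>a * form_norm a u\<^sub>1 * form_norm a u\<^sub>2"
    and \<gamma>: "0 < \<gamma>\<^sub>c" "\<gamma>\<^sub>c < 1" "0 < \<gamma>\<^sub>a" "\<gamma>\<^sub>a < 1" and \<tau>: "\<tau> > 0"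
    and sol: "partially_explicit_solution a b c d ip \<tau> N f V Q u p"
    and cfl: "\<forall>q\<in>Q 2. (form_norm b q)\<^sup>2 \<le> (1 - \<gamma>\<^sub>c) / \<tau> * (form_norm c q)\<^sup>2"
    and n: "n \<in> {1..N-1}"
    and source: "\<And>q \<delta>. q \<in> Y \<Longrightarrow> \<delta> > 0 \<Longrightarrow>
      2 * \<tau> * ip (f (real n * \<tau>)) q \<le> \<delta> * c q q + \<tau>\<^sup>2 / \<delta> * F" and F: "F \<ge> 0"
  shows "(\<Sum>i\<in>{1,2}. \<gamma>\<^sub>c * (form_norm c (p i (n+1) - p i n))\<^sup>2
                   + \<gamma>\<^sub>a * (form_norm a (u i (n+1) - u i n))\<^sup>2)
        + \<tau> * (form_norm b (p 1 (n+1) + p 2 (n+1)))\<^sup>2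
    \<le> (\<Sum>i\<in>{1,2}. \<gamma>\<^sub>c * (form_norm c (p i n - p i (n-1)))\<^sup>2
                   + \<gamma>\<^sub>a * (form_norm a (u i n - u i (n-1)))\<^sup>2)
        + \<tau> * (form_norm b (p 1 n + p 2 n))\<^sup>2 + 2 * \<tau>\<^sup>2 / (1 - \<gamma>\<^sub>c) * F"
proof -
  have V: "subspace V" "bilinear_on V V a" and Y: "subspace Y" "bilinear_on Y Y c" "bilinear_on Y Y b"
    using a b c by (auto simp: psd_form_on_def)
  \<comment> \<open>Increments from level \<open>m\<close> to \<open>m + 1\<close>; with \<open>n = Suc k\<close>, those indexed by \<open>k\<close> are the lagged ones.\<close>
  define e w where "e i m = p i (m + 1) - p i m" and "w i m = u i (m + 1) - u i m" for i m
  obtain k where k: "n = Suc k" using n by (cases n) auto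
  have le: "n \<le> N" "n + 1 \<le> N" "k \<le> N" "k + 1 \<le> N" using n k by auto
  have pQ: "p 1 m \<in> Q 1" "p 2 m \<in> Q 2" "u 1 m \<in> V" "u 2 m \<in> V" if "m \<le> N" for m
    using sol that by (auto simp: partially_explicit_solution_def)
  have eQ: "e 1 m \<in> Q 1" "e 2 m \<in> Q 2" and wV: "w 1 m \<in> V" "w 2 m \<in> V" if "m + 1 \<le> N" for m
    using pQ[of m] pQ[of "m + 1"] that Q V(1) by (auto simp: e_def w_def intro: subspace_diff)
  have eY: "e 1 m \<in> Y" "e 2 m \<in> Y" if "m + 1 \<le> N" for m
    using eQ[OF that] Q by auto
  have pY: "p 1 m \<in> Y" "p 2 m \<in> Y" if "m \<le> N" for m
    using pQ[OF that] Q by auto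
  have response: "a (w 1 m) v = d v (e 1 m)" "a (w 2 m) v = d v (e 2 m)"
    if "m + 1 \<le> N" "v \<in> V" for m v
  proof -
    have "a (u 1 l) v = d v (p 1 l)" "a (u 2 l) v = d v (p 2 l)" if "l \<le> N" for l
      using sol that \<open>v \<in> V\<close> by (auto simp: partially_explicit_solution_def)
    from this[of m] this[of "m + 1"]
    show "a (w 1 m) v = d v (e 1 m)" "a (w 2 m) v = d v (e 2 m)"
      using that pQ[of m] pQ[of "m + 1"] pY[of m] pY[of "m + 1"]
      by (simp_all add: e_def w_def bilinear_on_diff[OF V(2) V(1) V(1)] bilinear_on_diff[OF d V(1) Y(1)])
  qed
  have elastic: "w 1 m \<in> elastic_responses a d V (Q 1)" "w 2 m \<in> elastic_responses a d V (Q 2)"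
    if "m + 1 \<le> N" for m
    using response[OF that] eQ[OF that] wV[OF that] by (auto simp: elastic_responses_def)

  have sym: "a x y = a y x" if "x \<in> V" "y \<in> V" for x y
    using a that by (simp add: psd_form_on_def)
  have increments: "D_tau \<tau> (u i) (n + 1) = (1 / \<tau>) *\<^sub>R w i n" "D_tau \<tau> (u i) n = (1 / \<tau>) *\<^sub>R w i k"
    "D_tau \<tau> (p i) (n + 1) = (1 / \<tau>) *\<^sub>R e i n" "D_tau \<tau> (p i) n = (1 / \<tau>) *\<^sub>R e i k" for i
    by (simp_all add: D_tau_def e_def w_def k divide_inverse)
  define P0 P1 where "P0 = p 1 n + p 2 n" and "P1 = p 1 (n + 1) + p 2 (n + 1)"
  have PY: "P0 \<in> Y" "P1 \<in> Y"
    using pY le Y(1) by (auto simp: P0_def P1_def intro: subspace_add)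
  have PE: "P1 - P0 = e 1 n + e 2 n" "p 1 (n + 1) + p 2 n = P1 - e 2 n"
    by (simp_all add: P0_def P1_def e_def)
  have tested: "a (w i n) (w i n) + a (w j k) (w i n) + c (e i n) (e i n) + c (e j k) (e i n)
      + \<tau> * b (P1 - e 2 n) (e i n) = \<tau> * ip (f (real n * \<tau>)) (e i n)"
    if "(i, j) \<in> {(1, 2), (2, 1)}" for i j
  proof -
    have ij: "e i n \<in> Y" "e j k \<in> Y" "w i n \<in> V" "w j k \<in> V"
      using that eY wV le by auto
    have "d (D_tau \<tau> (u i) (n + 1) + D_tau \<tau> (u j) n) (e i n)
        + c (D_tau \<tau> (p i) (n + 1) + D_tau \<tau> (p j) n) (e i n)
        + b (p 1 (n + 1) + p 2 n) (e i n) = ip (f (real n * \<tau>)) (e i n)"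
      using sol n that eQ[OF le(2)] unfolding partially_explicit_solution_def by blast
    moreover have "d (w i n) (e i n) = a (w i n) (w i n)" "d (w j k) (e i n) = a (w j k) (w i n)"
      using that response[OF le(2)] ij sym[OF ij(4,3)] by auto
    ultimately have "(a (w i n) (w i n) + a (w j k) (w i n) + c (e i n) (e i n) + c (e j k) (e i n)) / \<tau>
        + b (P1 - e 2 n) (e i n) = ip (f (real n * \<tau>)) (e i n)"
      using ij V(1) Y(1) unfolding increments PE(2)
      by (simp add: bilinear_onD(1,2)[OF d] bilinear_onD(1,2)[OF Y(2)] subspace_scale add_divide_distrib)
    then show ?thesis using \<tau> by (simp add: field_simps)
  qed
  define bb where "bb = b (P1 - e 2 n) (e 1 n) + b (P1 - e 2 n) (e 2 n)"
  have bb: "2 * bb \<ge> b P1 P1 - b P0 P0 - b (e 2 n) (e 2 n)"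
  proof -
    have E: "e 1 n + e 2 n \<in> Y" "P1 - e 2 n \<in> Y"
      using eY[OF le(2)] PY Y(1) by (auto intro: subspace_add subspace_diff)
    have "bb = b (P1 - e 2 n) (e 1 n + e 2 n)"
      using eY[OF le(2)] E by (simp add: bb_def bilinear_onD(3)[OF Y(3)])
    also have "\<dots> = b P1 (P1 - P0) - b (e 2 n) (e 1 n + e 2 n)"
      using eY[OF le(2)] E PY by (simp add: bilinear_on_diff(1)[OF Y(3) Y(1) Y(1)] PE(1))
    finally show ?thesis
      using psd_form_polarization[OF b PY(2,1)] psd_form_young[OF b eY(2)[OF le(2)] E(1)] PE(1)
      by simp
  qed
  \<comment> \<open>Only products of a new and a lagged increment of different components occur, so the
    strengthened inequalities apply to each of them.\<close>
  have young_c: "- (2 * c x y) \<le> \<gamma>\<^sub>c * (c x x + c y y)" if "x \<in> Q 1" "y \<in> Q 2" for x y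
    by (rule strengthened_cauchy_schwarz_young[OF c, of _ "Q 1"])
       (use that Q cs_c \<gamma> in \<open>auto intro: subspace_neg\<close>)
  have sym_c: "c x y = c y x" if "x \<in> Y" "y \<in> Y" for x y
    using c that by (simp add: psd_form_on_def)
  have young_a: "- (2 * a x y) \<le> \<gamma>\<^sub>a * (a x x + a y y)"
    if xy: "x \<in> elastic_responses a d V (Q 1)" "y \<in> elastic_responses a d V (Q 2)" for x y
  proof (rule strengthened_cauchy_schwarz_young[OF a, of _ "elastic_responses a d V (Q 1)"])
    obtain q where q: "x \<in> V" "q \<in> Q 1" "\<forall>v\<in>V. a x v = d v q"
      using xy(1) unfolding elastic_responses_def by blast
    have "a (- x) v = d v (- q)" if "v \<in> V" for v
      using q that Q(2) bilinear_onD(2)[OF V(2), of x v "-1"] bilinear_onD(4)[OF d, of v q "-1"] by auto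
    then show "- x \<in> elastic_responses a d V (Q 1)"
      using q Q(1) V(1) by (auto simp: elastic_responses_def intro: subspace_neg)
    show "x \<in> V" "y \<in> V" using xy by (auto simp: elastic_responses_def)
  qed (use cs_a xy \<gamma> in auto)
  have "\<gamma>\<^sub>c * (c (e 1 n) (e 1 n) + c (e 2 n) (e 2 n)) + \<gamma>\<^sub>a * (a (w 1 n) (w 1 n) + a (w 2 n) (w 2 n)) + \<tau> * b P1 P1
    \<le> \<gamma>\<^sub>c * (c (e 1 k) (e 1 k) + c (e 2 k) (e 2 k)) + \<gamma>\<^sub>a * (a (w 1 k) (w 1 k) + a (w 2 k) (w 2 k)) + \<tau> * b P0 P0
      + 2 * \<tau>\<^sup>2 / (1 - \<gamma>\<^sub>c) * F"
  proof (rule energy_balance_arithmetic)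
    show "a (w 1 n) (w 1 n) + a (w 2 n) (w 2 n) + a (w 1 n) (w 2 k) + a (w 1 k) (w 2 n)
        + c (e 1 n) (e 1 n) + c (e 2 n) (e 2 n) + c (e 1 n) (e 2 k) + c (e 1 k) (e 2 n) + \<tau> * bb
      = \<tau> * (ip (f (real n * \<tau>)) (e 1 n) + ip (f (real n * \<tau>)) (e 2 n))"
      using tested[of 1 2] tested[of 2 1] sym[OF wV(1)[OF le(2)] wV(2)[OF le(4)]]
        sym_c[OF eY(1)[OF le(2)] eY(2)[OF le(4)]]
      by (simp add: bb_def distrib_left)
    show "- (2 * a (w 1 n) (w 2 k)) \<le> \<gamma>\<^sub>a * (a (w 1 n) (w 1 n) + a (w 2 k) (w 2 k))"
      by (intro young_a elastic le)
    show "- (2 * a (w 1 k) (w 2 n)) \<le> \<gamma>\<^sub>a * (a (w 2 n) (w 2 n) + a (w 1 k) (w 1 k))"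
      by (subst add.commute) (intro young_a elastic le)
    show "- (2 * c (e 1 n) (e 2 k)) \<le> \<gamma>\<^sub>c * (c (e 1 n) (e 1 n) + c (e 2 k) (e 2 k))"
      by (intro young_c eQ le)
    show "- (2 * c (e 1 k) (e 2 n)) \<le> \<gamma>\<^sub>c * (c (e 2 n) (e 2 n) + c (e 1 k) (e 1 k))"
      by (subst add.commute) (intro young_c eQ le)
    show "\<tau> * b (e 2 n) (e 2 n) \<le> (1 - \<gamma>\<^sub>c) * c (e 2 n) (e 2 n)"
      using cfl[rule_format, OF eQ(2)[OF le(2)]] \<tau>
      by (simp add: form_norm_power2[OF b eY(2)[OF le(2)]] form_norm_power2[OF c eY(2)[OF le(2)]] field_simps)
    show "2 * \<tau> * ip (f (real n * \<tau>)) (e 1 n)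
        \<le> 2 * (1 - \<gamma>\<^sub>c) * c (e 1 n) (e 1 n) + \<tau>\<^sup>2 / (2 * (1 - \<gamma>\<^sub>c)) * F"
      using \<gamma> by (intro source eY le) auto
    show "2 * \<tau> * ip (f (real n * \<tau>)) (e 2 n)
        \<le> (1 - \<gamma>\<^sub>c) * c (e 2 n) (e 2 n) + \<tau>\<^sup>2 / (1 - \<gamma>\<^sub>c) * F"
      using \<gamma> by (intro source eY le) auto
    show "0 \<le> a (w 1 n) (w 1 n)" "0 \<le> a (w 2 n) (w 2 n)"
      using a wV[OF le(2)] by (auto simp: psd_form_on_def)
  qed (use bb \<tau> \<gamma> F in auto)
  moreover have "p i (n + 1) - p i n = e i n" "p i n - p i (n - 1) = e i k"
    "u i (n + 1) - u i n = w i n" "u i n - u i (n - 1) = w i k" for i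
    by (simp_all add: e_def w_def k)
  ultimately show ?thesis
    using eY[OF le(2)] eY[OF le(4)] wV[OF le(2)] wV[OF le(4)] PY
    unfolding P0_def[symmetric] P1_def[symmetric]
    by (simp add: form_norm_power2[OF a] form_norm_power2[OF b] form_norm_power2[OF c] distrib_left)
qed


section \<open>Stability of the partially explicit scheme\<close>

theorem theorem3p1:
  fixes \<Omega> :: "(real^'d) set"
    and T \<tau> M \<nu> \<gamma>\<^sub>c \<gamma>\<^sub>a :: real and N :: nat
    and lam \<mu> \<kappa> \<alpha> :: "real^'d \<Rightarrow> real"
    and f :: "real \<Rightarrow> real^'d \<Rightarrow> real"
    and V\<^sub>H :: "(real^'d \<Rightarrow> real^'d) set" and Q :: "nat \<Rightarrow> (real^'d \<Rightarrow> real) set"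
    and u :: "nat \<Rightarrow> nat \<Rightarrow> real^'d \<Rightarrow> real^'d" and p :: "nat \<Rightarrow> nat \<Rightarrow> real^'d \<Rightarrow> real"
  defines "a \<equiv> form_a \<Omega> lam \<mu>" and "b \<equiv> form_b \<Omega> \<kappa> \<nu>"
    and "c \<equiv> form_c \<Omega> M" and "d \<equiv> form_d \<Omega> \<alpha>"
  assumes "CARD('d) \<in> {2, 3}" and "bounded_polyhedral_lipschitz_domain \<Omega>"
    and "T > 0" and "N \<ge> 1" and "\<tau> = T / real N"
    and "positive_coefficient \<Omega> lam" and "positive_coefficient \<Omega> \<mu>"
    and "positive_coefficient \<Omega> \<kappa>" and "biot_willis_coefficient \<Omega> \<alpha>"
    and "M > 0" and "\<nu> > 0"
    and "\<forall>t\<in>{0..T}. f t \<in> L2_space \<Omega>"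
    and "finite_dim_subspace \<Omega> V\<^sub>H" and "V\<^sub>H \<subseteq> H10_vec \<Omega>"
    and "\<forall>i\<in>{1,2}. finite_dim_subspace \<Omega> (Q i) \<and> Q i \<subseteq> H10 \<Omega>"
    and "0 < \<gamma>\<^sub>c" and "\<gamma>\<^sub>c < 1" and "0 < \<gamma>\<^sub>a" and "\<gamma>\<^sub>a < 1"
    and "\<forall>p\<^sub>1\<in>Q 1. \<forall>p\<^sub>2\<in>Q 2. c p\<^sub>1 p\<^sub>2 \<le> \<gamma>\<^sub>c * form_norm c p\<^sub>1 * form_norm c p\<^sub>2"
    and "\<forall>u\<^sub>1\<in>elastic_responses a d V\<^sub>H (Q 1). \<forall>u\<^sub>2\<in>elastic_responses a d V\<^sub>H (Q 2).
           a u\<^sub>1 u\<^sub>2 \<le> \<gamma>\<^sub>a * form_norm a u\<^sub>1 * form_norm a u\<^sub>2"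
    and "partially_explicit_solution a b c d (L2_inner \<Omega>) \<tau> N f V\<^sub>H Q u p"
    and "\<forall>q\<in>Q 2. (form_norm b q)\<^sup>2 \<le> (1 - \<gamma>\<^sub>c) / \<tau> * (form_norm c q)\<^sup>2"
  shows "\<forall>n\<in>{1..N-1}.
      (\<Sum>i\<in>{1,2}. \<gamma>\<^sub>c * (form_norm c (p i (n+1) - p i n))\<^sup>2
                   + \<gamma>\<^sub>a * (form_norm a (u i (n+1) - u i n))\<^sup>2)
        + \<tau> * (form_norm b (p 1 (n+1) + p 2 (n+1)))\<^sup>2
    \<le> (\<Sum>i\<in>{1,2}. \<gamma>\<^sub>c * (form_norm c (p i n - p i (n-1)))\<^sup>2
                   + \<gamma>\<^sub>a * (form_norm a (u i n - u i (n-1)))\<^sup>2)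
        + \<tau> * (form_norm b (p 1 n + p 2 n))\<^sup>2
        + 2 * \<tau>\<^sup>2 / (1 - \<gamma>\<^sub>c) * (L2_norm \<Omega> (\<lambda>x. sqrt M * f (real n * \<tau>) x))\<^sup>2"
proof
  fix n assume n: "n \<in> {1..N-1}"
  have \<Omega>: "open \<Omega>"
    using assms(6) by (simp add: bounded_polyhedral_lipschitz_domain_def lipschitz_domain_def)
  have \<tau>: "\<tau> > 0"
    using \<open>T > 0\<close> \<open>N \<ge> 1\<close> \<open>\<tau> = T / real N\<close> by simp
  \<comment> \<open>The forms are bilinear on all of \<open>H1\<close>, and the discrete spaces are subspaces of it.\<close>
  have V: "subspace V\<^sub>H" "V\<^sub>H \<subseteq> H1_vec \<Omega>"
    using \<open>finite_dim_subspace \<Omega> V\<^sub>H\<close> \<open>V\<^sub>H \<subseteq> H10_vec \<Omega>\<close>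
    by (auto simp: finite_dim_subspace_def H10_vec_def H10_def H1_vec_def)
  have Q: "subspace (Q i)" "Q i \<subseteq> H1 \<Omega>" if "i \<in> {1, 2}" for i
    using \<open>\<forall>i\<in>{1,2}. finite_dim_subspace \<Omega> (Q i) \<and> Q i \<subseteq> H10 \<Omega>\<close> that
    by (auto simp: finite_dim_subspace_def H10_def)
  have a: "psd_form_on V\<^sub>H a"
    unfolding a_def
    by (rule psd_form_on_subset[OF psd_form_a[OF \<Omega> \<open>positive_coefficient \<Omega> lam\<close> \<open>positive_coefficient \<Omega> \<mu>\<close>] V])
  have d: "bilinear_on V\<^sub>H (H1 \<Omega>) d"
    unfolding d_def
    by (rule bilinear_on_subset[OF bilinear_form_d[OF \<Omega> \<open>biot_willis_coefficient \<Omega> \<alpha>\<close>] V(2)]) simp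
  have b: "psd_form_on (H1 \<Omega>) b"
    unfolding b_def by (rule psd_form_b[OF \<Omega> \<open>positive_coefficient \<Omega> \<kappa>\<close> \<open>\<nu> > 0\<close>])
  have c: "psd_form_on (H1 \<Omega>) c"
    unfolding c_def by (rule psd_form_c[OF \<Omega> \<open>M > 0\<close>])
  have "real n * T \<le> T * real N"
    using n \<open>T > 0\<close> by auto
  then have "real n * \<tau> \<in> {0..T}"
    using \<open>N \<ge> 1\<close> \<open>T > 0\<close> by (simp add: \<open>\<tau> = T / real N\<close> field_simps)
  then have f: "f (real n * \<tau>) \<in> L2_space \<Omega>"
    using \<open>\<forall>t\<in>{0..T}. f t \<in> L2_space \<Omega>\<close> by blast
  have source: "2 * \<tau> * L2_inner \<Omega> (f (real n * \<tau>)) q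
      \<le> \<delta> * c q q + \<tau>\<^sup>2 / \<delta> * (L2_norm \<Omega> (\<lambda>x. sqrt M * f (real n * \<tau>) x))\<^sup>2"
    if "q \<in> H1 \<Omega>" "\<delta> > 0" for q \<delta>
    unfolding c_def using that by (intro source_term_young f \<open>M > 0\<close>) (auto simp: H1_def)
  show "(\<Sum>i\<in>{1,2}. \<gamma>\<^sub>c * (form_norm c (p i (n+1) - p i n))\<^sup>2
                   + \<gamma>\<^sub>a * (form_norm a (u i (n+1) - u i n))\<^sup>2)
        + \<tau> * (form_norm b (p 1 (n+1) + p 2 (n+1)))\<^sup>2
    \<le> (\<Sum>i\<in>{1,2}. \<gamma>\<^sub>c * (form_norm c (p i n - p i (n-1)))\<^sup>2
                   + \<gamma>\<^sub>a * (form_norm a (u i n - u i (n-1)))\<^sup>2)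
        + \<tau> * (form_norm b (p 1 n + p 2 n))\<^sup>2
        + 2 * \<tau>\<^sup>2 / (1 - \<gamma>\<^sub>c) * (L2_norm \<Omega> (\<lambda>x. sqrt M * f (real n * \<tau>) x))\<^sup>2"
    by (rule partially_explicit_energy_estimate[OF a b c d Q(1)[of 1] Q(2)[of 1] Q(1)[of 2] Q(2)[of 2]])
       (fact assms \<tau> n | rule source, assumption+ | simp)+
qed

end
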